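(* Let $\omega^*:=\beta\omega\setminus\omega$. Then the topological group $C_p(\omega^*,\mathbb{T})$ is $g$-dense in its completion but is not $g$-barrelled.
   Context: $\mathbb{T}=\mathbb{R}/\mathbb{Z}$ is the circle group. $\beta\omega$ is the Stone–Čech compactification of the discrete space $\omega=\{0,1,2,\dots\}$. $C_p(X,\mathbb{T})$ is the group of all continuous functions $X\to\mathbb{T}$ with pointwise addition and the topology of pointwise convergence on $X$; it is totally bounded (Hausdorff, and for every nonempty open $U$ finitely many translates of $U$ cover the group), and its completion is a compact Hausdorff abelian group. For an abelian topological group $G$, $\widehat{G}$ is the group of continuous homomorphisms $G\to\mathbb{T}$ and $\widehat{G}_p$ is $\widehat{G}$ with the topology of pointwise convergence on $G$. For a topological abelian group $K$ and a sequence $u=(u_n)$ in $\widehat{K}$, let $s_u(K)=\{x\in K:\lim_n u_n(x)=0 \text{ in } \mathbb{T}\}$. A subgroup $G$ of $K$ is $g$-dense in $K$ if, for every sequence $u=(u_n)$ in $\widehat{K}$, $G\subseteq s_u(K)$ implies $s_u(K)=K$. A topological abelian group $G$ is $g$-barrelled if every compact subset of $\widehat{G}_p$ is equicontinuous. *)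

theory Defs
  imports "HOL-Analysis.Analysis" "HOL-Algebra.Group"
begin

section \<open>The circle group\<close>

quotient_type circle = real / "\<lambda>x y :: real. x - y \<in> \<int>"
  morphisms rep_circle to_circle
proof (rule equivpI)
  show "reflp (\<lambda>x y :: real. x - y \<in> \<int>)"
    by (simp add: reflp_def)
  show "symp (\<lambda>x y :: real. x - y \<in> \<int>)"
    by (rule sympI) (metis Ints_minus minus_diff_eq)
  show "transp (\<lambda>x y :: real. x - y \<in> \<int>)"
    by (rule transpI) (metis Ints_add diff_add_cancel add_diff_eq)
qed

instantiation circle :: ab_group_add
begin

lift_definition zero_circle :: circle is "0 :: real" .

lift_definition plus_circle :: "circle \<Rightarrow> circle \<Rightarrow> circle" is "(+)"
proof -
  fix a b c d :: real
  assume "a - b \<in> \<int>" "c - d \<in> \<int>"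
  then have "(a - b) + (c - d) \<in> \<int>" by (rule Ints_add)
  then show "(a + c) - (b + d) \<in> \<int>" by (simp add: algebra_simps)
qed

lift_definition uminus_circle :: "circle \<Rightarrow> circle" is "uminus"
proof -
  fix a b :: real
  assume "a - b \<in> \<int>"
  then have "- (a - b) \<in> \<int>" by (rule Ints_minus)
  then show "- a - - b \<in> \<int>" by simp
qed

definition minus_circle :: "circle \<Rightarrow> circle \<Rightarrow> circle" where
  "minus_circle a b = a + - b"

instance
proof
  fix a b c :: circle
  show "a + b + c = a + (b + c)" by transfer (simp add: algebra_simps)
  show "a + b = b + a" by transfer (simp add: algebra_simps)
  show "0 + a = a" by transfer simp
  show "- a + a = 0" by transfer simp
  show "a - b = a + - b" by (rule minus_circle_def)
qed

end

instantiation circle :: topological_space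
begin

definition open_circle :: "circle set \<Rightarrow> bool" where
  "open_circle U \<longleftrightarrow> open (to_circle -` U)"

instance
  by standard (auto simp: open_circle_def vimage_Union)

end

section \<open>Abelian topological groups\<close>

record 'a top_group = "'a monoid" +
  gtop :: "'a topology"

definition topological_ab_group :: "'a top_group \<Rightarrow> bool" where
  "topological_ab_group G \<longleftrightarrow>
     comm_group G \<and> topspace (gtop G) = carrier G \<and>
     continuous_map (prod_topology (gtop G) (gtop G)) (gtop G) (\<lambda>(x, y). x \<otimes>\<^bsub>G\<^esub> y) \<and>
     continuous_map (gtop G) (gtop G) (\<lambda>x. inv\<^bsub>G\<^esub> x)"

definition circle_group :: "circle top_group" where
  "circle_group = \<lparr>carrier = UNIV, mult = (+), one = 0, gtop = euclidean\<rparr>"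

text \<open>A set \<open>S\<close> of circle-valued functions on \<open>A\<close> with pointwise addition and the topology
  of pointwise convergence on \<open>A\<close>. Functions on \<open>A\<close> are represented by extensional functions.\<close>

definition pointwise_group :: "'x set \<Rightarrow> ('x \<Rightarrow> circle) set \<Rightarrow> ('x \<Rightarrow> circle) top_group" where
  "pointwise_group A S =
     \<lparr>carrier = S, mult = (\<lambda>f g. \<lambda>x\<in>A. f x + g x), one = (\<lambda>x\<in>A. 0),
      gtop = subtopology (product_topology (\<lambda>_. euclidean) A) S\<rparr>"

definition Cp :: "'x topology \<Rightarrow> ('x \<Rightarrow> circle) top_group" where
  "Cp X = pointwise_group (topspace X)
     {f \<in> extensional (topspace X). continuous_map X euclidean f}"

definition characters :: "'a top_group \<Rightarrow> ('a \<Rightarrow> circle) set" where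
  "characters G =
     {h \<in> extensional (carrier G). h \<in> hom G circle_group \<and> continuous_map (gtop G) euclidean h}"

definition dual_p :: "'a top_group \<Rightarrow> ('a \<Rightarrow> circle) top_group" where
  "dual_p G = pointwise_group (carrier G) (characters G)"

section \<open>Completions\<close>

definition cauchy_filter_in :: "'a top_group \<Rightarrow> 'a filter \<Rightarrow> bool" where
  "cauchy_filter_in G F \<longleftrightarrow>
     F \<noteq> bot \<and> F \<le> principal (carrier G) \<and>
     (\<forall>U. openin (gtop G) U \<and> \<one>\<^bsub>G\<^esub> \<in> U \<longrightarrow>
        (\<exists>A. A \<subseteq> carrier G \<and> eventually (\<lambda>x. x \<in> A) F \<and>
             (\<forall>x\<in>A. \<forall>y\<in>A. x \<otimes>\<^bsub>G\<^esub> inv\<^bsub>G\<^esub> y \<in> U)))"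

definition complete_group :: "'a top_group \<Rightarrow> bool" where
  "complete_group G \<longleftrightarrow>
     (\<forall>F. cauchy_filter_in G F \<longrightarrow> (\<exists>x. limitin (gtop G) (\<lambda>y. y) x F))"

text \<open>\<open>K\<close> together with \<open>e\<close> is a (Hausdorff) completion of \<open>G\<close>: a complete Hausdorff group
  containing, via \<open>e\<close>, \<open>G\<close> as a dense topological subgroup.\<close>

definition is_completion :: "'a top_group \<Rightarrow> 'k top_group \<Rightarrow> ('a \<Rightarrow> 'k) \<Rightarrow> bool" where
  "is_completion G K e \<longleftrightarrow>
     topological_ab_group K \<and> Hausdorff_space (gtop K) \<and> complete_group K \<and>
     e \<in> hom G K \<and> embedding_map (gtop G) (gtop K) e \<and>
     gtop K closure_of (e ` carrier G) = carrier K"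

section \<open>\<open>g\<close>-dense subgroups and \<open>g\<close>-barrelled groups\<close>

definition s_set :: "'a top_group \<Rightarrow> (nat \<Rightarrow> 'a \<Rightarrow> circle) \<Rightarrow> 'a set" where
  "s_set K u = {x \<in> carrier K. (\<lambda>n. u n x) \<longlonglongrightarrow> 0}"

definition g_dense :: "'a set \<Rightarrow> 'a top_group \<Rightarrow> bool" where
  "g_dense H K \<longleftrightarrow>
     subgroup H K \<and>
     (\<forall>u. (\<forall>n. u n \<in> characters K) \<longrightarrow> H \<subseteq> s_set K u \<longrightarrow> s_set K u = carrier K)"

definition equicontinuous_in :: "'a top_group \<Rightarrow> ('a \<Rightarrow> circle) set \<Rightarrow> bool" where
  "equicontinuous_in G C \<longleftrightarrow>
     (\<forall>x\<in>carrier G. \<forall>V. open V \<and> 0 \<in> V \<longrightarrow>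
        (\<exists>U. openin (gtop G) U \<and> x \<in> U \<and> (\<forall>h\<in>C. \<forall>y\<in>U. h y - h x \<in> V)))"

definition g_barrelled :: "'a top_group \<Rightarrow> bool" where
  "g_barrelled G \<longleftrightarrow> (\<forall>C. compactin (gtop (dual_p G)) C \<longrightarrow> equicontinuous_in G C)"

section \<open>The Stone-Cech compactification\<close>

text \<open>Tychonoff's construction: the closure of the image of \<open>X\<close> under the evaluation map
  into the cube indexed by all continuous maps from \<open>X\<close> to the unit interval.\<close>

definition unit_maps :: "'a topology \<Rightarrow> ('a \<Rightarrow> real) set" where
  "unit_maps X = {f. continuous_map X (top_of_set {0..1}) f}"

definition stone_cech_map :: "'a topology \<Rightarrow> 'a \<Rightarrow> ('a \<Rightarrow> real) \<Rightarrow> real" where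
  "stone_cech_map X x = (\<lambda>f\<in>unit_maps X. f x)"

definition stone_cech :: "'a topology \<Rightarrow> (('a \<Rightarrow> real) \<Rightarrow> real) topology" where
  "stone_cech X =
     (let P = product_topology (\<lambda>_. top_of_set {0..1}) (unit_maps X)
      in subtopology P (P closure_of (stone_cech_map X ` topspace X)))"

definition beta_omega :: "((nat \<Rightarrow> real) \<Rightarrow> real) topology" where
  "beta_omega = stone_cech (discrete_topology UNIV)"

definition omega_star :: "((nat \<Rightarrow> real) \<Rightarrow> real) topology" where
  "omega_star = subtopology beta_omega
     (topspace beta_omega - range (stone_cech_map (discrete_topology UNIV)))"

section \<open>Topological groups of circle-valued functions and their completions\<close>

lemma to_circle_add: "to_circle (x + y) = to_circle x + to_circle y"
  by (simp add: plus_circle.abs_eq)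
lemma to_circle_minus: "to_circle (- x) = - to_circle x"
  by (simp add: uminus_circle.abs_eq)
lemma to_circle_eq_iff: "to_circle x = to_circle y \<longleftrightarrow> x - y \<in> \<int>"
  by (simp add: circle.abs_eq_iff)
lemma to_circle_surj: "\<exists>x. a = to_circle x"
  by (metis Quotient3_abs_rep Quotient3_circle)

lemma open_to_circle_image:
  assumes "open U" shows "open (to_circle ` U)"
proof -
  have "to_circle -` (to_circle ` U) = (\<Union>n\<in>\<int>. (\<lambda>x. n + x) ` U)"
  proof (intro Set.set_eqI iffI)
    fix x assume "x \<in> to_circle -` (to_circle ` U)"
    then obtain y where "y \<in> U" "x - y \<in> \<int>" by (auto simp: to_circle_eq_iff)
    then show "x \<in> (\<Union>n\<in>\<int>. (\<lambda>x. n + x) ` U)"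
      by (intro UN_I[of "x-y"]) (auto simp: image_iff intro!: bexI[of _ y])
  next
    fix x assume "x \<in> (\<Union>n\<in>\<int>. (\<lambda>x. n + x) ` U)"
    then obtain n y where "n \<in> \<int>" "y \<in> U" "x = n + y" by auto
    then show "x \<in> to_circle -` (to_circle ` U)"
      by (auto simp: image_iff to_circle_eq_iff intro!: bexI[of _ y])
  qed
  then show ?thesis using assms by (auto simp: open_circle_def intro!: open_translation)
qed

lemma continuous_to_circle: "continuous_on UNIV to_circle"
  by (auto simp: continuous_on_open_vimage open_circle_def)

instance circle :: t2_space
proof
  fix a b :: circle assume ne: "a \<noteq> b"
  obtain x y where ab: "a = to_circle x" "b = to_circle y" using to_circle_surj by metis
  define f where "f t = cis (2 * pi * t)" for t
  have f: "f s = f t \<longleftrightarrow> s - t \<in> \<int>" for s t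
  proof -
    have "f s = f t \<longleftrightarrow> (\<exists>n::int. 2 * pi * s = 2 * pi * t + 2 * pi * of_int n)"
      unfolding f_def complex_eq_iff cis.sel
      using sin_cos_eq_iff[where y = "2 * pi * s" and x = "2 * pi * t"] by (simp only: conj_commute)
    also have "\<dots> \<longleftrightarrow> (\<exists>n::int. s = t + of_int n)"
    proof (rule arg_cong[of _ _ Ex], rule ext)
      fix n :: int
      have "2 * pi * t + 2 * pi * of_int n = 2 * pi * (t + of_int n)" by (simp only: distrib_left)
      then show "(2 * pi * s = 2 * pi * t + 2 * pi * of_int n) = (s = t + of_int n)" by simp
    qed
    also have "\<dots> \<longleftrightarrow> s - t \<in> \<int>"
      by (metis Ints_cases Ints_of_int add_diff_cancel_left' add.commute diff_add_cancel)
    finally show ?thesis .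
  qed
  have "f x \<noteq> f y" using ne by (simp add: ab f to_circle_eq_iff)
  then obtain U V where UV: "open U" "open V" "f x \<in> U" "f y \<in> V" "U \<inter> V = {}"
    by (metis hausdorff)
  have cf: "continuous_on UNIV f" unfolding f_def cis_conv_exp by (intro continuous_intros)
  have "open (to_circle ` (f -` U))" "open (to_circle ` (f -` V))"
    by (intro open_to_circle_image open_vimage UV cf)+
  moreover have "to_circle ` (f -` U) \<inter> to_circle ` (f -` V) = {}"
  proof (rule ccontr)
    assume "\<not> ?thesis"
    then obtain s t where "f s \<in> U" "f t \<in> V" "to_circle s = to_circle t"
      by (auto simp only: disjoint_iff image_iff vimage_eq)
    then have "f s = f t" using f to_circle_eq_iff by blast
    then show False using UV(5) \<open>f s \<in> U\<close> \<open>f t \<in> V\<close> by (metis disjoint_iff)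
  qed
  ultimately show "\<exists>U V. open U \<and> open V \<and> a \<in> U \<and> b \<in> V \<and> U \<inter> V = {}"
    using UV(3,4) ab by (intro exI conjI) auto
qed

instance circle :: topological_ab_group_add
proof
  fix a b :: circle
  obtain x y where ab: "a = to_circle x" "b = to_circle y" using to_circle_surj by metis
  show "((\<lambda>z. fst z + snd z) \<longlongrightarrow> a + b) (nhds a \<times>\<^sub>F nhds b)"
  proof (rule topological_tendstoI)
    fix S assume S: "open S" "a + b \<in> S"
    have "open ((\<lambda>p. fst p + snd p) -` (to_circle -` S) :: (real \<times> real) set)"
      by (rule open_vimage) (use S in \<open>auto simp: open_circle_def intro!: continuous_intros\<close>)
    moreover have "(x, y) \<in> (\<lambda>p. fst p + snd p) -` (to_circle -` S)"
      using S ab by (simp add: to_circle_add)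
    ultimately obtain A B where AB: "open A" "open B" "(x,y) \<in> A \<times> B"
       "A \<times> B \<subseteq> (\<lambda>p. fst p + snd p) -` (to_circle -` S)"
      by (elim open_prod_elim) blast
    have 1: "eventually (\<lambda>c. c \<in> to_circle ` A) (nhds a)" "eventually (\<lambda>c. c \<in> to_circle ` B) (nhds b)"
      using AB ab by (auto intro!: eventually_nhds_in_open open_to_circle_image)
    have 2: "c + d \<in> S" if "c \<in> to_circle ` A" "d \<in> to_circle ` B" for c d
      using that AB(4) by (force simp: to_circle_add)
    show "eventually (\<lambda>z. fst z + snd z \<in> S) (nhds a \<times>\<^sub>F nhds b)"
      using eventually_prodI[OF 1] by eventually_elim (use 2 in auto)
  qed
  show "(uminus \<longlongrightarrow> - a) (nhds a)"
  proof (rule topological_tendstoI)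
    fix S assume S: "open S" "- a \<in> S"
    have "open (uminus -` (to_circle -` S) :: real set)"
      by (rule open_vimage) (use S in \<open>auto simp: open_circle_def intro!: continuous_intros\<close>)
    then have "open (uminus -` S)"
      by (simp add: open_circle_def vimage_def to_circle_minus)
    then have "eventually (\<lambda>c. c \<in> uminus -` S) (nhds a)"
      using S by (intro eventually_nhds_in_open) auto
    then show "eventually (\<lambda>c. - c \<in> S) (nhds a)" by simp
  qed
qed

lemma compact_circle: "compact (UNIV :: circle set)"
proof -
  have "to_circle ` {0..1} = UNIV"
  proof (intro Set.set_eqI iffI UNIV_I)
    fix a obtain x where a: "a = to_circle x" using to_circle_surj by metis
    have "a = to_circle (frac x)" by (simp add: a to_circle_eq_iff frac_def)
    then show "a \<in> to_circle ` {0..1}" 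
      by (rule ssubst) (auto intro!: imageI simp: frac_ge_0 frac_lt_1 less_imp_le)
  qed
  then show ?thesis
    using compact_continuous_image[OF continuous_on_subset[OF continuous_to_circle subset_UNIV] compact_Icc[of 0 1]]
    by simp
qed

lemma continuous_map_circle_add:
  fixes f g :: "'a \<Rightarrow> circle"
  assumes "continuous_map X euclidean f" "continuous_map X euclidean g"
  shows "continuous_map X euclidean (\<lambda>x. f x + g x)"
  using assms unfolding continuous_map_atin limitin_canonical_iff
  by (auto intro: tendsto_add)
lemma continuous_map_circle_minus:
  fixes f g :: "'a \<Rightarrow> circle"
  assumes "continuous_map X euclidean f"
  shows "continuous_map X euclidean (\<lambda>x. - f x)"
  using assms unfolding continuous_map_atin limitin_canonical_iff
  by (auto intro: tendsto_minus)

definition pw_closed :: "'x set \<Rightarrow> ('x \<Rightarrow> circle) set \<Rightarrow> bool" where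
  "pw_closed A S \<longleftrightarrow> S \<subseteq> extensional A \<and>
  (\<lambda>x\<in>A. 0::circle) \<in> S \<and> (\<forall>f\<in>S. \<forall>g\<in>S. (\<lambda>x\<in>A. f x + g x) \<in> S) \<and> (\<forall>f\<in>S. (\<lambda>x\<in>A. - f x) \<in> S)"

lemma pw_comm_group: assumes "pw_closed A S" shows "comm_group (pointwise_group A S)"
proof (rule comm_groupI)
  have S: "S \<subseteq> extensional A" using assms by (simp add: pw_closed_def)
  fix f assume f: "f \<in> carrier (pointwise_group A S)"
  show "\<one>\<^bsub>pointwise_group A S\<^esub> \<otimes>\<^bsub>pointwise_group A S\<^esub> f = f"
    using f S by (auto simp: pointwise_group_def fun_eq_iff extensional_def restrict_def)
  show "\<exists>y\<in>carrier (pointwise_group A S). y \<otimes>\<^bsub>pointwise_group A S\<^esub> f = \<one>\<^bsub>pointwise_group A S\<^esub>"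
    using f assms by (intro bexI[of _ "\<lambda>x\<in>A. - f x"]) (auto simp: pointwise_group_def pw_closed_def fun_eq_iff)
qed (use assms in \<open>auto simp: pointwise_group_def pw_closed_def fun_eq_iff add_ac restrict_def\<close>)

lemma pw_inv: assumes "pw_closed A S" "f \<in> S" shows "inv\<^bsub>pointwise_group A S\<^esub> f = (\<lambda>x\<in>A. - f x)"
proof -
  interpret comm_group "pointwise_group A S" by (rule pw_comm_group[OF assms(1)])
  show ?thesis using assms
    by (intro inv_equality) (auto simp: pointwise_group_def pw_closed_def fun_eq_iff)
qed

lemma pw_topgroup: assumes "pw_closed A S" shows "topological_ab_group (pointwise_group A S)"
proof -
  let ?T = "subtopology (product_topology (\<lambda>_. euclidean) A) S :: ('a \<Rightarrow> circle) topology"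
  have S: "S \<subseteq> extensional A" using assms by (simp add: pw_closed_def)
  have ts: "topspace ?T = S" using S by (auto simp: PiE_def)
  have pr: "continuous_map ?T euclidean (\<lambda>f. f x)" if "x \<in> A" for x
    using that by (intro continuous_map_from_subtopology continuous_map_product_projection)
  have 1: "continuous_map (prod_topology ?T ?T) ?T (\<lambda>(f,g). \<lambda>x\<in>A. f x + g x)"
    unfolding continuous_map_in_subtopology continuous_map_componentwise
  proof (intro conjI ballI)
    fix x assume x: "x \<in> A"
    have "continuous_map (prod_topology ?T ?T) euclidean (\<lambda>p. fst p x + snd p x)"
      using continuous_map_compose[OF continuous_map_fst pr[OF x], of ?T]
        continuous_map_compose[OF continuous_map_snd pr[OF x], of ?T]
      by (intro continuous_map_circle_add) (auto simp: o_def)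
    then show "continuous_map (prod_topology ?T ?T) euclidean (\<lambda>p. (case p of (f, g) \<Rightarrow> \<lambda>x\<in>A. f x + g x) x)"
      using x by (simp add: case_prod_beta)
  qed (use assms ts in \<open>auto simp: pw_closed_def\<close>)
  have "continuous_map ?T ?T (\<lambda>f. \<lambda>x\<in>A. - f x)"
    unfolding continuous_map_in_subtopology continuous_map_componentwise
  proof (intro conjI ballI)
    fix x assume x: "x \<in> A"
    show "continuous_map ?T euclidean (\<lambda>f. (\<lambda>x\<in>A. - f x) x)"
      using continuous_map_circle_minus[OF pr[OF x]] x by simp
  qed (use assms ts in \<open>auto simp: pw_closed_def\<close>)
  then have 2: "continuous_map ?T ?T (\<lambda>f. inv\<^bsub>pointwise_group A S\<^esub> f)"
    by (rule continuous_map_eq) (use ts pw_inv[OF assms] in auto)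
  show ?thesis unfolding topological_ab_group_def
    using pw_comm_group[OF assms] 1 2 ts by (simp add: pointwise_group_def)
qed

lemma Cp_closed: "pw_closed (topspace X) {f \<in> extensional (topspace X). continuous_map X (euclidean::circle topology) f}"
proof -
  have r: "continuous_map X euclidean (restrict f (topspace X))" if "continuous_map X euclidean f" for f :: "_ \<Rightarrow> circle"
    using that by (rule continuous_map_eq) auto
  show ?thesis unfolding pw_closed_def
    by (auto intro!: r continuous_map_circle_add continuous_map_circle_minus)
qed

lemma Cp_topgroup: "topological_ab_group (Cp X)"
  unfolding Cp_def by (rule pw_topgroup[OF Cp_closed])

lemma dual_closed: assumes "topological_ab_group G" shows "pw_closed (carrier G) (characters G)"
proof -
  interpret comm_group G using assms by (simp add: topological_ab_group_def)
  have t: "topspace (gtop G) = carrier G" using assms by (simp add: topological_ab_group_def)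
  have r: "continuous_map (gtop G) euclidean (restrict f (carrier G))" if "continuous_map (gtop G) euclidean f" for f :: "_ \<Rightarrow> circle"
    using that by (rule continuous_map_eq) (auto simp: t)
  show ?thesis unfolding pw_closed_def
    by (auto simp: characters_def hom_def circle_group_def intro!: r continuous_map_circle_add continuous_map_circle_minus)
qed

lemma compact_complete:
  assumes G: "topological_ab_group G" and c: "compact_space (gtop G)"
  shows "complete_group G"
  unfolding complete_group_def
proof (intro allI impI)
  fix F assume F: "cauchy_filter_in G F"
  interpret comm_group G using G by (simp add: topological_ab_group_def)
  have t: "topspace (gtop G) = carrier G" using G by (simp add: topological_ab_group_def)
  have "\<Inter>{gtop G closure_of A | A. eventually (\<lambda>x. x \<in> A) F} \<noteq> {}"
  proof (rule c[unfolded compact_space_fip, rule_format], intro conjI ballI allI impI)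
    fix \<F> assume f: "finite \<F> \<and> \<F> \<subseteq> {gtop G closure_of A | A. eventually (\<lambda>x. x \<in> A) F}"
    have ev: "eventually (\<lambda>x. x \<in> carrier G) F" using F by (simp add: cauchy_filter_in_def le_principal)
    have "eventually (\<lambda>x. \<forall>C\<in>\<F>. x \<in> C) F"
    proof (intro eventually_ball_finite ballI)
      fix C assume "C \<in> \<F>"
      then obtain A where A: "C = gtop G closure_of A" "eventually (\<lambda>x. x \<in> A) F" using f by auto
      show "eventually (\<lambda>x. x \<in> C) F"
        using A(2) ev by eventually_elim (use A(1) t closure_of_subset_Int[of "gtop G" A] in auto)
    qed (use f in auto)
    moreover have "F \<noteq> bot" using F by (simp add: cauchy_filter_in_def)
    ultimately have "\<exists>x. \<forall>C\<in>\<F>. x \<in> C" using eventually_happens'[of F "\<lambda>x. \<forall>C\<in>\<F>. x \<in> C"] by simp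
    then show "\<Inter>\<F> \<noteq> {}" by auto
  next
    fix C assume "C \<in> {gtop G closure_of A | A. eventually (\<lambda>x. x \<in> A) F}"
    then show "closedin (gtop G) C" by auto
  qed
  then obtain x where x: "\<And>A. eventually (\<lambda>x. x \<in> A) F \<Longrightarrow> x \<in> gtop G closure_of A" by auto
  have xc: "x \<in> carrier G" using x[of UNIV] t by (simp add: in_closure_of)
  show "\<exists>x. limitin (gtop G) (\<lambda>y. y) x F"
  proof (intro exI[of _ x], unfold limitin_def, intro conjI allI impI)
    show "x \<in> topspace (gtop G)" using xc t by simp
    fix U assume U: "openin (gtop G) U \<and> x \<in> U"
    let ?m = "\<lambda>(x, y). x \<otimes>\<^bsub>G\<^esub> y"
    have cm: "continuous_map (prod_topology (gtop G) (gtop G)) (gtop G) ?m"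
      using G by (simp add: topological_ab_group_def)
    have "openin (prod_topology (gtop G) (gtop G)) {p \<in> topspace (prod_topology (gtop G) (gtop G)). ?m p \<in> U}"
      by (rule openin_continuous_map_preimage[OF cm]) (use U in simp)
    moreover have "(\<one>\<^bsub>G\<^esub>, x) \<in> {p \<in> topspace (prod_topology (gtop G) (gtop G)). ?m p \<in> U}"
      using xc U t by simp
    ultimately have "\<exists>V W. openin (gtop G) V \<and> openin (gtop G) W \<and> \<one>\<^bsub>G\<^esub> \<in> V \<and> x \<in> W \<and>
      V \<times> W \<subseteq> {p \<in> topspace (prod_topology (gtop G) (gtop G)). ?m p \<in> U}"
      by (rule openin_prod_topology_alt[THEN iffD1, rule_format])
    then obtain V W where VW: "openin (gtop G) V" "openin (gtop G) W" "\<one>\<^bsub>G\<^esub> \<in> V" "x \<in> W"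
      "V \<times> W \<subseteq> {p \<in> topspace (prod_topology (gtop G) (gtop G)). ?m p \<in> U}"
      by (elim exE conjE) (rule that)
    obtain A where A: "A \<subseteq> carrier G" "eventually (\<lambda>x. x \<in> A) F"
      "\<And>y z. y \<in> A \<Longrightarrow> z \<in> A \<Longrightarrow> y \<otimes>\<^bsub>G\<^esub> inv\<^bsub>G\<^esub> z \<in> V"
    proof -
      have "\<exists>A. A \<subseteq> carrier G \<and> eventually (\<lambda>x. x \<in> A) F \<and> (\<forall>x\<in>A. \<forall>y\<in>A. x \<otimes>\<^bsub>G\<^esub> inv\<^bsub>G\<^esub> y \<in> V)"
        using F VW(1,3) by (simp add: cauchy_filter_in_def)
      then show ?thesis using that by auto
    qed
    obtain z where z: "z \<in> A" "z \<in> W" using x[OF A(2)] VW(2,4) unfolding in_closure_of by auto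
    have "A \<subseteq> U"
    proof
      fix y assume y: "y \<in> A"
      have "(y \<otimes>\<^bsub>G\<^esub> inv\<^bsub>G\<^esub> z, z) \<in> V \<times> W" using A(3)[OF y z(1)] z by simp
      from subsetD[OF VW(5) this] have "(y \<otimes>\<^bsub>G\<^esub> inv\<^bsub>G\<^esub> z) \<otimes>\<^bsub>G\<^esub> z \<in> U" by simp
      moreover have "y \<in> carrier G" "z \<in> carrier G" using y z A(1) by auto
      ultimately show "y \<in> U" by (simp add: m_assoc)
    qed
    then show "eventually (\<lambda>y. y \<in> U) F" by (intro eventually_mono[OF A(2)]) auto
  qed
qed

text \<open>The completion of \<open>Cp X\<close>, realised as its closure in the power of the circle
  indexed by the points of \<open>X\<close>.\<close>

lemma completion_exists:
  fixes X :: "'x topology"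
  shows "\<exists>(K :: ('x \<Rightarrow> circle) top_group) e. is_completion (Cp X) K e"
proof -
  define A where "A = topspace X"
  define P where "P = (product_topology (\<lambda>_. euclidean) A :: ('x \<Rightarrow> circle) topology)"
  define S0 where "S0 = {f \<in> extensional A. continuous_map X (euclidean::circle topology) f}"
  define S where "S = P closure_of S0"
  have c0: "pw_closed A S0" unfolding A_def S0_def by (rule Cp_closed)
  define E where "E = (extensional A :: ('x \<Rightarrow> circle) set)"
  have tP: "topspace P = E" by (auto simp: P_def E_def PiE_def)
  have cE: "pw_closed A E" by (auto simp: pw_closed_def E_def)
  have gE: "topological_ab_group (pointwise_group A E)" by (rule pw_topgroup[OF cE])
  have PE: "subtopology P E = P" by (metis tP subtopology_topspace)
  have add: "continuous_map (prod_topology P P) P (\<lambda>(f,g). \<lambda>x\<in>A. f x + g x)"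
    using gE by (simp add: topological_ab_group_def pointwise_group_def PE flip: P_def)
  have "continuous_map P P (\<lambda>f. inv\<^bsub>pointwise_group A E\<^esub> f)"
    using gE by (simp add: topological_ab_group_def pointwise_group_def PE flip: P_def)
  then have minus: "continuous_map P P (\<lambda>f. \<lambda>x\<in>A. - f x)"
    by (rule continuous_map_eq) (use pw_inv[OF cE] tP in auto)
  have S0S: "S0 \<subseteq> S" unfolding S_def by (rule closure_of_subset) (auto simp: S0_def tP E_def)
  have SE: "S \<subseteq> E" unfolding S_def using closure_of_subset_topspace tP by metis
  have cS: "pw_closed A S"
    unfolding pw_closed_def
  proof (intro conjI ballI)
    show "S \<subseteq> extensional A" using SE E_def by simp
    show "(\<lambda>x\<in>A. 0) \<in> S" using S0S c0 by (auto simp: pw_closed_def)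
    fix f assume f: "f \<in> S"
    have "(\<lambda>f. \<lambda>x\<in>A. - f x) ` S \<subseteq> P closure_of ((\<lambda>f. \<lambda>x\<in>A. - f x) ` S0)"
      unfolding S_def by (rule continuous_map_image_closure_subset[OF minus])
    also have "\<dots> \<subseteq> S" unfolding S_def using c0 by (intro closure_of_mono) (auto simp: pw_closed_def)
    finally show "(\<lambda>x\<in>A. - f x) \<in> S" using f by auto
    fix g assume g: "g \<in> S"
    have "(\<lambda>(f,g). \<lambda>x\<in>A. f x + g x) ` (S \<times> S) \<subseteq> P closure_of ((\<lambda>(f,g). \<lambda>x\<in>A. f x + g x) ` (S0 \<times> S0))"
      using continuous_map_image_closure_subset[OF add, of "S0 \<times> S0"] unfolding S_def closure_of_Times .
    also have "\<dots> \<subseteq> S" unfolding S_def using c0 by (intro closure_of_mono) (auto simp: pw_closed_def)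
    finally show "(\<lambda>x\<in>A. f x + g x) \<in> S" using f g by auto
  qed
  let ?K = "pointwise_group A S"
  have Cp: "Cp X = pointwise_group A S0" by (simp add: Cp_def A_def S0_def)
  have gt: "gtop ?K = subtopology P S" by (simp add: pointwise_group_def P_def)
  have gt0: "gtop (Cp X) = subtopology P S0" by (simp add: Cp pointwise_group_def P_def)
  have K: "topological_ab_group ?K" by (rule pw_topgroup[OF cS])
  have "compact_space P" unfolding P_def
    unfolding compact_space_product_topology by (simp add: compact_space_def compact_circle)
  then have cK: "compact_space (gtop ?K)" unfolding gt
    by (intro compact_space_subtopology closedin_compact_space) (simp_all add: S_def)
  have hK: "Hausdorff_space (gtop ?K)" unfolding gt P_def
  proof (intro Hausdorff_space_subtopology)
    have "Hausdorff_space (euclidean :: circle topology)"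
      unfolding Hausdorff_space_def by (simp add: disjnt_def) (metis hausdorff)
    then show "Hausdorff_space (product_topology (\<lambda>_. euclidean :: circle topology) A)"
      by (simp add: Hausdorff_space_product_topology)
  qed
  have sub: "subtopology (subtopology P S) S0 = subtopology P S0"
    using S0S by (simp add: subtopology_subtopology Int_absorb1)
  have emb: "embedding_map (gtop (Cp X)) (gtop ?K) (\<lambda>f. f)"
  proof -
    have "topspace (subtopology P S0) = S0" using S0S SE tP by auto
    then show ?thesis unfolding embedding_map_def gt gt0 using homeomorphic_map_id[of "subtopology P S0"] by (simp add: sub id_def)
  qed
  have dense: "gtop ?K closure_of ((\<lambda>f. f) ` carrier (Cp X)) = carrier ?K"
    using S0S by (simp add: gt Cp pointwise_group_def closure_of_subtopology Int_absorb1 P_def S_def)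
  have hom: "(\<lambda>f. f) \<in> hom (Cp X) ?K"
    using S0S by (auto simp: hom_def Cp pointwise_group_def)
  show ?thesis
    using K hK compact_complete[OF K cK] hom emb dense
    by (intro exI[of _ ?K] exI[of _ "\<lambda>f. f"]) (simp only: is_completion_def simp_thms)
qed

end

(* Restricted to Cp omega_star, the characters u n become characters of finite support converging to
  zero pointwise. Composed with the extension of sequences from omega to the Stone-Cech compactification,
  they are functionals on circle-valued sequences. For each fixed set A, the Baire category theorem in
  the circle shows that they eventually vanish on all multiples of the indicator of A. If infinitely many
  of them were nonzero, a gliding hump would glue multiples of indicators of disjoint sets to one sequence
  on which they do not tend to zero; finiteness of supports makes the tails harmless. So the u n
  eventually vanish on a dense subgroup, hence everywhere. For the second claim, the evaluations at
  points of omega_star form a compact set that is not equicontinuous, since omega_star is infinite. *)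

theory Submission
  imports Defs
begin

section \<open>Convergent sequences of characters of the circle\<close>

definition circle_arc :: "real \<Rightarrow> circle set" where
  "circle_arc r = to_circle ` ball 0 r"

lemma open_circle_arc: "open (circle_arc r)"
  unfolding circle_arc_def by (intro open_to_circle_image open_ball)

lemma zero_in_circle_arc: "r > 0 \<Longrightarrow> 0 \<in> circle_arc r"
  unfolding circle_arc_def zero_circle.abs_eq by (intro imageI) simp

lemma circle_arc_add:
  assumes "a \<in> circle_arc r" "b \<in> circle_arc s" shows "a + b \<in> circle_arc (r + s)"
proof -
  obtain x y where "a = to_circle x" "\<bar>x\<bar> < r" "b = to_circle y" "\<bar>y\<bar> < s"
    using assms by (auto simp: circle_arc_def)
  then show ?thesis
    unfolding circle_arc_def by (intro image_eqI[of _ _ "x + y"]) (auto simp: to_circle_add)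
qed

lemma circle_arc_uminus: "a \<in> circle_arc r \<Longrightarrow> - a \<in> circle_arc r"
  unfolding circle_arc_def by (force simp flip: to_circle_minus)

lemma circle_arc_diff: "a \<in> circle_arc r \<Longrightarrow> b \<in> circle_arc s \<Longrightarrow> a - b \<in> circle_arc (r + s)"
  using circle_arc_add[of a r "- b" s] circle_arc_uminus by simp

text \<open>Doubling a representative of modulus below 1/4 gives a number of modulus below 1/2; as
  it is congruent modulo 1 to some number of modulus below 1/4, it equals that number. So
  \<open>2 ^ n * x\<close> stays bounded for all \<open>n\<close>, which forces
  \<open>x = 0\<close>.\<close>

lemma circle_arc_no_small_subgroups:
  assumes dbl: "\<And>a. a \<in> H \<Longrightarrow> a + a \<in> H" and sub: "H \<subseteq> circle_arc (1/4)" and "a \<in> H"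
  shows "a = 0"
proof -
  obtain x where x: "a = to_circle x" "\<bar>x\<bar> < 1/4" using assms by (auto simp: circle_arc_def)
  have "to_circle (2 ^ n * x) \<in> H \<and> \<bar>2 ^ n * x\<bar> < 1/4" for n
  proof (induction n)
    case (Suc n)
    then have "to_circle (2 ^ Suc n * x) \<in> H"
      using dbl[of "to_circle (2 ^ n * x)"] by (simp add: algebra_simps flip: to_circle_add)
    then obtain y where y: "\<bar>y\<bar> < 1/4" "2 ^ Suc n * x - y \<in> \<int>"
      using sub by (auto simp: circle_arc_def to_circle_eq_iff)
    have "\<bar>2 ^ Suc n * x - y\<bar> < 1" using Suc y by (simp add: abs_if split: if_splits)
    then have "2 ^ Suc n * x = y" using y(2) Ints_nonzero_abs_less1[of "2 ^ Suc n * x - y"] by simp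
    then show ?case using y \<open>to_circle (2 ^ Suc n * x) \<in> H\<close> by simp
  qed (use x assms in auto)
  then have *: "2 ^ n * \<bar>x\<bar> < 1/4" for n by (simp add: abs_mult)
  have "x = 0"
  proof (rule ccontr)
    assume "x \<noteq> 0"
    then obtain n where "1 / \<bar>x\<bar> < 2 ^ n" using real_arch_pow[of 2 "1 / \<bar>x\<bar>"] by auto
    then have "1 < 2 ^ n * \<bar>x\<bar>" using \<open>x \<noteq> 0\<close> by (simp add: field_simps)
    with *[of n] show False by simp
  qed
  then show ?thesis using x by (simp add: zero_circle.abs_eq)
qed

lemma Hausdorff_circle: "Hausdorff_space (euclidean :: circle topology)"
  unfolding Hausdorff_space_def by (simp add: disjnt_def) (metis hausdorff)

text \<open>By Baire, the \<open>\<kappa> n\<close> are eventually uniformly small on a nonempty open set. Finitely many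
  translates of it cover the circle, so they are eventually uniformly small everywhere, and the
  circle has no small subgroups.\<close>

lemma circle_characters_eventually_zero:
  fixes \<kappa> :: "nat \<Rightarrow> circle \<Rightarrow> circle"
  assumes add: "\<And>n s t. \<kappa> n (s + t) = \<kappa> n s + \<kappa> n t"
    and cont: "\<And>n. continuous_on UNIV (\<kappa> n)"
    and lim: "\<And>t. (\<lambda>n. \<kappa> n t) \<longlonglongrightarrow> 0"
  shows "\<forall>\<^sub>F n in sequentially. \<forall>t. \<kappa> n t = 0"
proof -
  \<comment> \<open>A compact arc between the open arcs of radii 1/16 and 1/8: it makes each
    \<open>E N\<close> closed, and 1/8 + 1/16 is still below 1/4.\<close>
  define C where "C = to_circle ` cball 0 (1/16)"
  have C: "closed C"
    unfolding C_def by (intro compact_imp_closed compact_continuous_image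
        continuous_on_subset[OF continuous_to_circle]) auto
  have C_arc: "C \<subseteq> circle_arc (1/8)" and arc_C: "circle_arc (1/16) \<subseteq> C"
    by (auto simp: C_def circle_arc_def)
  define E where "E N = {t. \<forall>n\<ge>N. \<kappa> n t \<in> C}" for N
  have E: "closed (E N)" for N
  proof -
    have "E N = (\<Inter>n\<in>{N..}. \<kappa> n -` C)" by (auto simp: E_def)
    then show ?thesis using C cont by (auto intro!: closed_vimage)
  qed
  have ev: "\<forall>\<^sub>F n in sequentially. \<kappa> n t \<in> circle_arc (1/16)" for t
    using topological_tendstoD[OF lim open_circle_arc zero_in_circle_arc] by simp
  have UN: "(\<Union>N. E N) = UNIV"
    using ev arc_C by (fastforce simp: E_def eventually_sequentially)
  have "\<exists>N. interior (E N) \<noteq> {}"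
  proof (rule ccontr)
    assume "\<not> ?thesis"
    moreover have "locally_compact_space (euclidean :: circle topology)"
      by (intro compact_imp_locally_compact_space) (simp add: compact_space_def compact_circle)
    ultimately have "(euclidean :: circle topology) interior_of \<Union>(range E) = {}"
      using E by (intro Baire_category_alt)
        (auto intro!: locally_compact_Hausdorff_imp_regular_space Hausdorff_circle)
    then show False by (simp add: UN)
  qed
  then obtain N where N: "interior (E N) \<noteq> {}" by blast
  define U where "U = interior (E N)"
  obtain u where u: "u \<in> U" using N by (auto simp: U_def)
  have oU: "open ((\<lambda>x. x - t) -` U)" for t
    by (rule open_vimage) (auto simp: U_def intro!: continuous_intros)
  have "UNIV \<subseteq> (\<Union>t. (\<lambda>x. x - t) -` U)"
  proof
    fix x show "x \<in> (\<Union>t. (\<lambda>x. x - t) -` U)" using u by (intro UN_I[of "x - u"]) auto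
  qed
  then obtain D where D: "finite D" "UNIV \<subseteq> (\<Union>t\<in>D. (\<lambda>x. x - t) -` U)"
    by - (rule compactE_image[OF compact_circle, of UNIV "\<lambda>t. (\<lambda>x. x - t) -` U"], use oU in auto)
  have "\<forall>\<^sub>F n in sequentially. \<forall>t\<in>D. \<kappa> n t \<in> circle_arc (1/16)"
    using D(1) ev by (simp add: eventually_ball_finite)
  with eventually_ge_at_top[of N] show ?thesis
  proof eventually_elim
    fix n assume n: "N \<le> n" "\<forall>t\<in>D. \<kappa> n t \<in> circle_arc (1/16)"
    have "range (\<kappa> n) \<subseteq> circle_arc (1/4)"
    proof clarify
      fix x obtain t where t: "t \<in> D" "x - t \<in> U" using D(2) by auto
      then have "x - t \<in> E N" using interior_subset by (auto simp: U_def)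
      then have "\<kappa> n (x - t) \<in> circle_arc (1/8)" using n C_arc by (auto simp: E_def)
      then have "\<kappa> n (x - t) + \<kappa> n t \<in> circle_arc (1/8 + 1/16)" using n t by (intro circle_arc_add) auto
      then have "\<kappa> n x \<in> circle_arc (1/8 + 1/16)" by (simp flip: add)
      then show "\<kappa> n x \<in> circle_arc (1/4)" by (auto simp: circle_arc_def)
    qed
    then have "a = 0" if "a \<in> range (\<kappa> n)" for a
      using that by (intro circle_arc_no_small_subgroups[of "range (\<kappa> n)"]) (auto simp flip: add)
    then show "\<forall>t. \<kappa> n t = 0" by blast
  qed
qed

section \<open>A gliding hump for functionals on circle-valued sequences\<close>

definition ind :: "'i set \<Rightarrow> circle \<Rightarrow> 'i \<Rightarrow> circle" where
  "ind A t = (\<lambda>i. if i \<in> A then t else 0)"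

lemma ind_split: "C \<subseteq> B \<Longrightarrow> ind B t = (\<lambda>i. ind C t i + ind (B - C) t i)"
  by (auto simp: ind_def fun_eq_iff)

text \<open>Models the n-th character evaluated at the extension of \<open>f\<close>.
  \<open>exhaust\<close> is the trace of finite support: finitely many ultrafilters cannot between
  them contain every set of an infinite disjoint family.\<close>

locale gliding_hump =
  fixes \<Phi> :: "nat \<Rightarrow> ('i \<Rightarrow> circle) \<Rightarrow> circle"
  assumes add: "\<And>n f g. \<Phi> n (\<lambda>i. f i + g i) = \<Phi> n f + \<Phi> n g"
    and cont: "\<And>n B. continuous_on UNIV (\<lambda>t. \<Phi> n (ind B t))"
    and exhaust: "\<And>n A. disjoint_family (A :: nat \<Rightarrow> 'i set) \<Longrightarrow>
      \<exists>k. \<forall>f. (\<forall>i. i \<notin> A k \<longrightarrow> f i = 0) \<longrightarrow> \<Phi> n f = 0"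
    and lim: "\<And>f. (\<lambda>n. \<Phi> n f) \<longlonglongrightarrow> 0"
begin

definition null :: "nat \<Rightarrow> 'i set \<Rightarrow> bool" where
  "null n A \<longleftrightarrow> (\<forall>f. (\<forall>i. i \<notin> A \<longrightarrow> f i = 0) \<longrightarrow> \<Phi> n f = 0)"

text \<open>Subsets of \<open>B\<close> enter because the values at \<open>ind B t\<close>
  themselves vanish for late \<open>n\<close>; activity then shows only on proper parts of
  \<open>B\<close>.\<close>

definition lives :: "nat \<Rightarrow> 'i set \<Rightarrow> bool" where
  "lives n B \<longleftrightarrow> (\<exists>C\<subseteq>B. \<exists>t. \<Phi> n (ind C t) \<noteq> 0)"

text \<open>A reservoir from which humps can be cut for arbitrarily late indices.\<close>

definition big :: "'i set \<Rightarrow> bool" where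
  "big B \<longleftrightarrow> (\<exists>\<^sub>F n in sequentially. lives n B)"

lemma lives_mono: "lives n B \<Longrightarrow> B \<subseteq> B' \<Longrightarrow> lives n B'"
  unfolding lives_def by blast

lemma ind_add: "ind A (s + t) = (\<lambda>i. ind A s i + ind A t i)"
  by (auto simp: ind_def)

lemma \<Phi>_ind_add: "\<Phi> n (ind A (s + t)) = \<Phi> n (ind A s) + \<Phi> n (ind A t)"
  unfolding ind_add add ..

text \<open>The threshold depends on \<open>B\<close>; making it uniform is the aim of the
  locale.\<close>

lemma eventually_ind_zero: "\<forall>\<^sub>F n in sequentially. \<forall>t. \<Phi> n (ind B t) = 0"
  by (intro circle_characters_eventually_zero lim cont) (rule \<Phi>_ind_add)

lemma lives_Diff:
  assumes "lives n B"
  shows "lives n C \<or> lives n (B - C)"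
proof -
  obtain D t where D: "D \<subseteq> B" "\<Phi> n (ind D t) \<noteq> 0" using assms by (auto simp: lives_def)
  have "\<Phi> n (ind D t) = \<Phi> n (ind (D \<inter> C) t) + \<Phi> n (ind (D - D \<inter> C) t)"
    by (simp add: ind_split[of "D \<inter> C" D t] add)
  then consider "\<Phi> n (ind (D \<inter> C) t) \<noteq> 0" | "\<Phi> n (ind (D - D \<inter> C) t) \<noteq> 0"
    using D(2) by (metis add_0)
  then show ?thesis
  proof cases
    case 1
    then have "lives n C" unfolding lives_def by (intro exI[of _ "D \<inter> C"]) auto
    then show ?thesis ..
  next
    case 2
    then have "lives n (B - C)"
      unfolding lives_def using D(1) by (intro exI[of _ "D - D \<inter> C"]) auto
    then show ?thesis ..
  qed
qed

lemma big_UnE: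
  assumes "big B" shows "big C \<or> big (B - C)"
proof -
  have "\<exists>\<^sub>F n in sequentially. lives n C \<or> lives n (B - C)"
    using assms unfolding big_def by (rule frequently_elim1) (rule lives_Diff)
  then show ?thesis by (simp add: big_def frequently_disj_iff)
qed

text \<open>For late \<open>n\<close> the whole of \<open>B\<close> contributes zero, so an active
  \<open>C\<close> forces \<open>B - C\<close> to be active with the opposite value. One of these
  two pieces is big, and \<open>A\<close> is chosen as the other one.\<close>

lemma big_split:
  assumes "big B"
  shows "\<forall>\<^sub>F n in sequentially. lives n B \<longrightarrow>
    (\<exists>A\<subseteq>B. (\<exists>t. \<Phi> n (ind A t) \<noteq> 0) \<and> big (B - A))"
  using eventually_ind_zero[of B]
proof eventually_elim
  fix n assume zero: "\<forall>t. \<Phi> n (ind B t) = 0"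
  show "lives n B \<longrightarrow> (\<exists>A\<subseteq>B. (\<exists>t. \<Phi> n (ind A t) \<noteq> 0) \<and> big (B - A))"
  proof
    assume "lives n B"
    then obtain C t where C: "C \<subseteq> B" "\<Phi> n (ind C t) \<noteq> 0" by (auto simp: lives_def)
    then have "\<Phi> n (ind (B - C) t) \<noteq> 0"
      using zero add[of n "ind C t" "ind (B - C) t"] by (auto simp flip: ind_split)
    moreover have "B - (B - C) = C" using C by auto
    ultimately show "\<exists>A\<subseteq>B. (\<exists>t. \<Phi> n (ind A t) \<noteq> 0) \<and> big (B - A)"
      using C big_UnE[OF assms, of C] by (metis Diff_subset)
  qed
qed

lemma big_split_ex:
  assumes "big B" "\<forall>\<^sub>F n in sequentially. P n"
  shows "\<exists>n A t. P n \<and> A \<subseteq> B \<and> \<Phi> n (ind A t) \<noteq> 0 \<and> big (B - A)"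
proof -
  have "\<exists>\<^sub>F n in sequentially. lives n B \<and> ((lives n B \<longrightarrow>
    (\<exists>A\<subseteq>B. (\<exists>t. \<Phi> n (ind A t) \<noteq> 0) \<and> big (B - A))) \<and> P n)"
    using assms(1)[unfolded big_def] eventually_conj[OF big_split[OF assms(1)] assms(2)]
    by (rule frequently_eventually_frequently)
  then show ?thesis by (elim frequentlyE) blast
qed

text \<open>Each step cuts an active piece off the remainder, keeps the rest big and moves on to a
  later index.\<close>

lemma disjoint_lives:
  assumes "big B"
  obtains A :: "nat \<Rightarrow> 'i set" and n :: "nat \<Rightarrow> nat"
  where "disjoint_family A" "strict_mono n" "\<And>k. A k \<subseteq> B" "\<And>k. lives (n k) (A k)"
proof -
  let ?P = "\<lambda>(k::nat) (R, A, n). A \<subseteq> B \<and> R \<subseteq> B - A \<and> big R \<and> lives n A"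
  let ?Q = "\<lambda>(k::nat) (R, A, n) (R', A', n'). A' \<subseteq> R \<and> R' \<subseteq> R \<and> (n::nat) < n'"
  have step: "\<exists>A n. A \<subseteq> R \<and> m < n \<and> lives n A \<and> big (R - A)" if "big R" for R m
    using big_split_ex[OF that eventually_gt_at_top[of m]] unfolding lives_def by blast
  have "\<exists>f. \<forall>k. ?P k (f k) \<and> ?Q k (f k) (f (Suc k))"
  proof (rule dependent_nat_choice)
    obtain A n where "A \<subseteq> B" "lives n A" "big (B - A)" using step[OF assms] by blast
    then show "\<exists>x. ?P 0 x" by (intro exI[of _ "(B - A, A, n)"]) auto
  next
    fix x k assume "?P k x"
    then obtain R A n where x: "x = (R, A, n)" "A \<subseteq> B" "R \<subseteq> B - A" "big R" by (cases x) auto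
    obtain A' n' where "A' \<subseteq> R" "n < n'" "lives n' A'" "big (R - A')" using step[OF x(4)] by blast
    then show "\<exists>y. ?P (Suc k) y \<and> ?Q k x y"
      using x by (intro exI[of _ "(R - A', A', n')"]) auto
  qed
  then obtain f where f: "\<forall>k. ?P k (f k) \<and> ?Q k (f k) (f (Suc k))" ..
  define R A n where "R k = fst (f k)" and "A k = fst (snd (f k))" and "n k = snd (snd (f k))" for k
  have P: "A k \<subseteq> B" "R k \<subseteq> B - A k" "lives (n k) (A k)" for k
    using conjunct1[OF spec[OF f, of k]] by (auto simp: R_def A_def n_def case_prod_beta)
  have Q: "A (Suc k) \<subseteq> R k" "R (Suc k) \<subseteq> R k" "n k < n (Suc k)" for k
    using conjunct2[OF spec[OF f, of k]] by (auto simp: R_def A_def n_def case_prod_beta)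
  have R: "R j \<subseteq> R k" if "k \<le> j" for j k
    using that by (rule lift_Suc_antimono_le[of R, OF Q(2)])
  have "A k \<inter> A j = {}" if "k < j" for j k
  proof -
    obtain l where "j = Suc l" "k \<le> l" using \<open>k < j\<close> by (cases j) auto
    then have "A j \<subseteq> R k" using Q(1)[of l] R[of k l] by blast
    then show ?thesis using P(2)[of k] by blast
  qed
  then have "disjoint_family A"
    unfolding disjoint_family_on_def by (metis Int_commute linorder_neq_iff)
  moreover have "strict_mono n" using Q(3) by (simp add: strict_mono_Suc_iff)
  ultimately show thesis using that P by blast
qed

text \<open>Grouping a disjoint sequence \<open>A\<close> along the rows of \<open>nat \<times> nat\<close> gives infinitely many
  disjoint big sets, one of which \<open>\<Phi> n\<close> ignores.\<close>

lemma big_null_subset: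
  assumes "big B"
  obtains B' where "B' \<subseteq> B" "big B'" "null n B'"
proof -
  obtain A :: "nat \<Rightarrow> 'i set" and m :: "nat \<Rightarrow> nat"
    where A: "disjoint_family A" "strict_mono m" "\<And>k. A k \<subseteq> B" "\<And>k. lives (m k) (A k)"
    by (rule disjoint_lives[OF assms]) blast
  define D where "D i = (\<Union>j. A (prod_encode (i, j)))" for i
  have "disjoint_family D"
    unfolding disjoint_family_on_def
  proof (intro ballI impI)
    fix i j :: nat assume "i \<noteq> j"
    then have "A (prod_encode (i, k)) \<inter> A (prod_encode (j, l)) = {}" for k l
      using A(1) by (simp add: disjoint_family_on_def)
    then show "D i \<inter> D j = {}" unfolding D_def by blast
  qed
  then obtain i where "null n (D i)" using exhaust unfolding null_def by blast
  moreover have "big (D i)"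
    unfolding big_def frequently_sequentially
  proof
    fix N
    have "N \<le> prod_encode (i, N)" by (rule le_prod_encode_2)
    also have "\<dots> \<le> m (prod_encode (i, N))" using A(2) by (rule strict_mono_imp_increasing)
    finally have "N \<le> m (prod_encode (i, N))" .
    moreover have "lives (m (prod_encode (i, N))) (D i)"
      by (rule lives_mono[OF A(4)]) (auto simp: D_def)
    ultimately show "\<exists>n\<ge>N. lives n (D i)" by blast
  qed
  moreover have "D i \<subseteq> B" using A(3) by (auto simp: D_def)
  ultimately show thesis using that by blast
qed

text \<open>\<open>n\<close> is so late that \<open>g\<close> contributes almost nothing; a hump on
  a part of \<open>B\<close> then makes the value large. As \<open>\<Phi> n\<close> ignores
  \<open>B'\<close>, later changes confined to \<open>B'\<close> cannot spoil this value.\<close>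

lemma hump_step:
  assumes "big B" and g: "\<And>i. i \<in> B \<Longrightarrow> g i = 0"
  obtains B' g' n where "N < n" "B' \<subseteq> B" "\<forall>i. i \<notin> B \<longrightarrow> g' i = g i" "\<forall>i\<in>B'. g' i = 0"
    "big B'" "null n B'" "\<Phi> n g' \<notin> circle_arc (1/8)"
proof -
  have "\<forall>\<^sub>F n in sequentially. N < n \<and> \<Phi> n g \<in> circle_arc (1/8)"
    using topological_tendstoD[OF lim open_circle_arc zero_in_circle_arc] eventually_gt_at_top
    by (intro eventually_conj) auto
  then obtain n A t where n: "N < n" "\<Phi> n g \<in> circle_arc (1/8)"
    and A: "A \<subseteq> B" "\<Phi> n (ind A t) \<noteq> 0" "big (B - A)"
    using big_split_ex[OF assms(1)] by blast
  \<comment> \<open>Closed under doubling and nontrivial, this set must leave the arc of radius 1/4;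
    that yields the height \<open>s\<close> of the hump.\<close>
  let ?H = "range (\<lambda>t. \<Phi> n (ind A t))"
  have "a + a \<in> ?H" if "a \<in> ?H" for a
    using that by (auto simp flip: \<Phi>_ind_add)
  then have "\<not> ?H \<subseteq> circle_arc (1/4)"
    using A(2) circle_arc_no_small_subgroups[of ?H "\<Phi> n (ind A t)"] by blast
  then obtain s where s: "\<Phi> n (ind A s) \<notin> circle_arc (1/4)" by auto
  obtain B' where B': "B' \<subseteq> B - A" "big B'" "null n B'" using big_null_subset[OF A(3)] .
  define g' where "g' i = g i + ind A s i" for i
  \<comment> \<open>1/8 + 1/8 = 1/4: a hump outside the large arc survives the addition of the small
    value at \<open>g\<close>.\<close>
  have "\<Phi> n g' \<notin> circle_arc (1/8)"
  proof
    assume "\<Phi> n g' \<in> circle_arc (1/8)"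
    then have "\<Phi> n g' - \<Phi> n g \<in> circle_arc (1/8 + 1/8)" using n by (intro circle_arc_diff)
    then show False using s by (simp add: g'_def[abs_def] add)
  qed
  moreover have "\<forall>i. i \<notin> B \<longrightarrow> g' i = g i" "\<forall>i\<in>B'. g' i = 0"
    using A(1) B'(1) g by (auto simp: g'_def ind_def)
  ultimately show thesis using n B' by (intro that[of n B' g']) auto
qed

text \<open>Otherwise infinitely many humps glue to a single \<open>h\<close> whose values
  \<open>\<Phi> (n k) h\<close> stay away from zero, against \<open>lim\<close> at
  \<open>h\<close>.\<close>

theorem eventually_zero_on_indicators:
  "\<forall>\<^sub>F n in sequentially. \<forall>A t. \<Phi> n (ind A t) = 0"
proof (rule ccontr)
  assume "\<not> ?thesis"
  then have "big UNIV" by (simp add: big_def lives_def frequently_def)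
  \<comment> \<open>The state consists of the reservoir, the function built so far and the index of
    the latest hump.\<close>
  let ?P = "\<lambda>(k::nat) (B, g, n). (\<forall>i\<in>B. g i = 0) \<and> big B \<and> null n B \<and> \<Phi> n g \<notin> circle_arc (1/8)"
  let ?Q = "\<lambda>(k::nat) (B, g, n) (B', g', n'). (n::nat) < n' \<and> B' \<subseteq> B \<and>
    (\<forall>i. i \<notin> B \<longrightarrow> g' i = (g i :: circle))"
  have "\<exists>f. \<forall>k. ?P k (f k) \<and> ?Q k (f k) (f (Suc k))"
  proof (rule dependent_nat_choice)
    obtain B g n where "\<forall>i\<in>B. g i = 0" "big B" "null n B" "\<Phi> n g \<notin> circle_arc (1/8)"
      by (rule hump_step[OF \<open>big UNIV\<close>, where g = "\<lambda>_. 0"], rule refl, rule that)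
    then show "\<exists>x. ?P 0 x" by (intro exI[of _ "(B, g, n)"]) auto
  next
    fix x k assume "?P k x"
    then obtain B g n where x: "x = (B, g, n)" "\<And>i. i \<in> B \<Longrightarrow> g i = 0" "big B" by (cases x) auto
    obtain B' g' n' where "n < n'" "B' \<subseteq> B" "\<forall>i. i \<notin> B \<longrightarrow> g' i = g i" "\<forall>i\<in>B'. g' i = 0"
      "big B'" "null n' B'" "\<Phi> n' g' \<notin> circle_arc (1/8)"
      by (rule hump_step[OF x(3), where g = g and N = n], erule x(2), rule that)
    then show "\<exists>y. ?P (Suc k) y \<and> ?Q k x y"
      using x(1) by (intro exI[of _ "(B', g', n')"]) auto
  qed
  then obtain f where f: "\<forall>k. ?P k (f k) \<and> ?Q k (f k) (f (Suc k))" ..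
  define B g n where "B k = fst (f k)" and "g k = fst (snd (f k))" and "n k = snd (snd (f k))" for k
  have P: "null (n k) (B k)" "\<Phi> (n k) (g k) \<notin> circle_arc (1/8)" for k
    using conjunct1[OF spec[OF f, of k]] by (auto simp: B_def g_def n_def case_prod_beta)
  have Q: "n k < n (Suc k)" "B (Suc k) \<subseteq> B k" "i \<notin> B k \<Longrightarrow> g (Suc k) i = g k i" for k i
    using conjunct2[OF spec[OF f, of k]] by (auto simp: B_def g_def n_def case_prod_beta)
  have g: "j \<ge> k \<Longrightarrow> i \<notin> B k \<Longrightarrow> i \<notin> B j \<and> g j i = g k i" for i j k
    by (induction j rule: dec_induct) (use Q in auto)
  \<comment> \<open>Off \<open>B k\<close> the value is final from stage \<open>k\<close> on, so the
    first such stage serves. A point lying in every \<open>B k\<close> gets the value 0, whatever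
    stage \<open>LEAST\<close> returns.\<close>
  define h where "h i = g (LEAST k. i \<notin> B k) i" for i
  have h: "h i = g k i" if "i \<notin> B k" for i k
    using g[of "LEAST k. i \<notin> B k" k i] LeastI[of "\<lambda>k. i \<notin> B k" k] Least_le[of "\<lambda>k. i \<notin> B k" k] that
    by (simp add: h_def)
  have "\<Phi> (n k) h = \<Phi> (n k) (g k)" for k
  proof -
    \<comment> \<open>All changes after stage \<open>k\<close> happen inside \<open>B k\<close>,
      which \<open>\<Phi> (n k)\<close> ignores.\<close>
    have "\<Phi> (n k) (\<lambda>i. h i - g k i) = 0" using P(1)[of k] h by (simp add: null_def)
    then show ?thesis using add[of "n k" "\<lambda>i. h i - g k i" "g k"] by simp
  qed
  then have *: "\<Phi> (n k) h \<notin> circle_arc (1/8)" for k using P(2) by simp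
  have "strict_mono n" using Q(1) by (simp add: strict_mono_Suc_iff)
  moreover have "\<forall>\<^sub>F m in sequentially. \<Phi> m h \<in> circle_arc (1/8)"
    by (rule topological_tendstoD[OF lim open_circle_arc zero_in_circle_arc]) simp
  ultimately have "\<forall>\<^sub>F k in sequentially. \<Phi> (n k) h \<in> circle_arc (1/8)"
    by (rule eventually_subseq)
  then show False using * by simp
qed

end

section \<open>Extending sequences to the Stone-Cech compactification\<close>

abbreviation pt :: "nat \<Rightarrow> (nat \<Rightarrow> real) \<Rightarrow> real" where
  "pt \<equiv> stone_cech_map (discrete_topology UNIV)"

lemma unit_maps_discrete: "unit_maps (discrete_topology UNIV) = {f. \<forall>i. 0 \<le> f i \<and> f i \<le> 1}"
  by (auto simp: unit_maps_def continuous_map_from_discrete_topology Pi_def)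

lemma pt_apply: "(\<And>i. 0 \<le> f i \<and> f i \<le> 1) \<Longrightarrow> pt n f = f n"
  by (simp add: stone_cech_map_def unit_maps_discrete)

definition cube :: "((nat \<Rightarrow> real) \<Rightarrow> real) topology" where
  "cube = product_topology (\<lambda>_. top_of_set {0..1}) (unit_maps (discrete_topology UNIV))"

lemma beta_omega_eq: "beta_omega = subtopology cube (cube closure_of range pt)"
  by (simp add: beta_omega_def stone_cech_def cube_def Let_def)

lemma topspace_cube: "topspace cube = PiE (unit_maps (discrete_topology UNIV)) (\<lambda>_. {0..1})"
  by (simp add: cube_def)

lemma topspace_beta_omega: "topspace beta_omega = cube closure_of range pt"
  unfolding beta_omega_eq using closure_of_subset_topspace by fastforce

lemma range_pt_subset: "range pt \<subseteq> topspace beta_omega"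
  unfolding topspace_beta_omega
  by (rule closure_of_subset)
    (simp add: topspace_cube stone_cech_map_def image_subset_iff restrict_PiE_iff unit_maps_discrete)

lemma pt_in_beta_omega: "pt n \<in> topspace beta_omega"
  using range_pt_subset by auto

lemma compact_beta_omega: "compact_space beta_omega"
  unfolding beta_omega_eq
  by (intro compact_space_subtopology closedin_compact_space closedin_closure_of)
    (simp add: cube_def compact_space_product_topology compact_space_subtopology)

lemma continuous_eval:
  assumes "\<And>i. 0 \<le> f i \<and> f i \<le> 1"
  shows "continuous_map beta_omega euclidean (\<lambda>x. x f)"
proof -
  have "continuous_map cube (top_of_set {0..1}) (\<lambda>x. x f)"
    unfolding cube_def by (rule continuous_map_product_projection) (simp add: unit_maps_discrete assms)
  then show ?thesis
    unfolding beta_omega_eq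
    by (intro continuous_map_from_subtopology) (simp add: continuous_map_in_subtopology)
qed

lemma beta_omega_dense:
  assumes "closedin beta_omega S" "\<And>n. pt n \<in> S" "x \<in> topspace beta_omega"
  shows "x \<in> S"
proof -
  have "x \<in> beta_omega closure_of range pt"
    using assms(3) range_pt_subset unfolding beta_omega_eq
    by (simp add: closure_of_subtopology topspace_beta_omega[unfolded beta_omega_eq] Int_absorb1)
  then show ?thesis
    using closure_of_minimal[OF _ assms(1), of "range pt"] assms(2) by blast
qed

text \<open>A union of two closed sets that contains every \<open>pt n\<close> is the whole space.
  The disjunction serves to transfer case distinctions and implications from omega.\<close>

lemma beta_omega_dense2:
  assumes "closedin Y C" "continuous_map beta_omega Y f"
    and "closedin Z D" "continuous_map beta_omega Z g"
    and "\<And>n. f (pt n) \<in> C \<or> g (pt n) \<in> D" "x \<in> topspace beta_omega"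
  shows "f x \<in> C \<or> g x \<in> D"
proof -
  have "closedin beta_omega ({x \<in> topspace beta_omega. f x \<in> C} \<union> {x \<in> topspace beta_omega. g x \<in> D})"
    using assms by (intro closedin_Un closedin_continuous_map_preimage)
  from beta_omega_dense[OF this _ assms(6)] show ?thesis
    using assms(5) pt_in_beta_omega by blast
qed

text \<open>Points of the compactification are read as ultrafilters on \<open>nat\<close>.\<close>

definition mem :: "((nat \<Rightarrow> real) \<Rightarrow> real) \<Rightarrow> nat set \<Rightarrow> bool" where
  "mem x A \<longleftrightarrow> x (indicator A) = 1"

lemma continuous_eval_indicator: "continuous_map beta_omega euclidean (\<lambda>x. x (indicator A))"
  by (rule continuous_eval) (simp add: indicator_def)

lemma pt_indicator [simp]: "pt n (indicator A) = indicator A n"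
  by (rule pt_apply) (simp add: indicator_def)

lemma eval_indicator:
  assumes "x \<in> topspace beta_omega" shows "x (indicator A) = (if mem x A then 1 else 0)"
proof -
  have "x (indicator A) \<in> {0} \<or> x (indicator A) \<in> {1}"
    by (rule beta_omega_dense2[OF _ continuous_eval_indicator _ continuous_eval_indicator _ assms])
      (auto simp: indicator_def)
  then show ?thesis by (auto simp: mem_def)
qed

lemma mem_pt [simp]: "mem (pt n) A \<longleftrightarrow> n \<in> A"
  by (simp add: mem_def indicator_def)

text \<open>Density relative to \<open>A\<close>: the points containing \<open>A\<close> lie in the
  closure of the \<open>pt n\<close> with \<open>n\<close> in \<open>A\<close>.\<close>

lemma mem_dense:
  assumes "closedin Y C" "continuous_map beta_omega Y f" "\<And>n. n \<in> A \<Longrightarrow> f (pt n) \<in> C"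
    and "x \<in> topspace beta_omega" "mem x A"
  shows "f x \<in> C"
proof -
  have "f x \<in> C \<or> x (indicator A) \<in> {0}"
    by (rule beta_omega_dense2[OF assms(1,2) _ continuous_eval_indicator _ assms(4)])
      (use assms(3) in \<open>auto simp: indicator_def\<close>)
  then show ?thesis using eval_indicator[OF assms(4), of A] assms(5) by auto
qed

lemma mem_disjoint:
  assumes "x \<in> topspace beta_omega" "mem x A" "mem x B" shows "A \<inter> B \<noteq> {}"
proof
  assume "A \<inter> B = {}"
  then have "x (indicator B) \<in> {0}"
    by (intro mem_dense[OF _ continuous_eval_indicator _ assms(1,2)]) (auto simp: indicator_def)
  then show False using assms(3) by (simp add: mem_def)
qed

lemma mem_Compl:
  assumes "x \<in> topspace beta_omega" shows "mem x (- A) \<longleftrightarrow> \<not> mem x A"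
proof -
  have "x (indicator A) \<in> {1} \<or> x (indicator (- A)) \<in> {1}"
    by (rule beta_omega_dense2[OF _ continuous_eval_indicator _ continuous_eval_indicator _ assms])
      (auto simp: indicator_def)
  then show ?thesis using mem_disjoint[OF assms, of A "- A"] by (auto simp: mem_def)
qed

lemma mem_UNIV: "x \<in> topspace beta_omega \<Longrightarrow> mem x UNIV"
  using mem_Compl[of x "{}"] mem_disjoint[of x "{}" "{}"] by auto

text \<open>Distinct points differ in some coordinate \<open>f\<close>; a level strictly between the
  two values cuts omega into two sets, one for each ultrafilter.\<close>

lemma mem_separates:
  assumes x: "x \<in> topspace beta_omega" and y: "y \<in> topspace beta_omega" and ne: "x \<noteq> y"
  obtains A where "mem x A" "\<not> mem y A"
proof -
  have "x \<in> extensional (unit_maps (discrete_topology UNIV))"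
    "y \<in> extensional (unit_maps (discrete_topology UNIV))"
    using x y closure_of_subset_topspace[of cube "range pt"]
    unfolding topspace_beta_omega topspace_cube by (auto simp: PiE_def)
  with ne obtain f where f: "f \<in> unit_maps (discrete_topology UNIV)" "x f \<noteq> y f"
    by (metis extensionalityI)
  then have cf: "continuous_map beta_omega euclidean (\<lambda>x. x f)" and pf: "\<And>n. pt n f = f n"
    by (auto intro!: continuous_eval pt_apply simp: unit_maps_discrete)
  have *: "\<exists>A. mem u A \<and> \<not> mem v A"
    if uv: "u \<in> topspace beta_omega" "v \<in> topspace beta_omega" "u f < v f" for u v
  proof -
    obtain c where c: "u f < c" "c < v f" using uv(3) dense by blast
    define A where "A = {i. f i < c}"
    have "\<not> mem u (- A)"
      using mem_dense[OF _ cf _ uv(1), of "{c..}" "- A"] c pf by (force simp: A_def)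
    moreover have "\<not> mem v A"
      using mem_dense[OF _ cf _ uv(2), of "{..c}" "A"] c pf by (force simp: A_def)
    ultimately show ?thesis using mem_Compl uv by blast
  qed
  show thesis
  proof (cases "x f < y f")
    case True
    then show thesis using *[OF x y] that by blast
  next
    case False
    then obtain A where "mem y A" "\<not> mem x A" using *[OF y x] f(2) by force
    then show thesis using that[of "- A"] mem_Compl x y by blast
  qed
qed

lemma mem_Int:
  assumes "x \<in> topspace beta_omega" shows "mem x (A \<inter> B) \<longleftrightarrow> mem x A \<and> mem x B"
proof -
  have "mem x A" if "mem x (A \<inter> B)" for A B
    using that mem_disjoint[OF assms, of "A \<inter> B" "- A"] mem_Compl[OF assms] by blast
  from this[of A B] this[of B A] have "mem x A \<and> mem x B" if "mem x (A \<inter> B)"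
    using that by (simp add: Int_commute)
  moreover have "mem x (A \<inter> B)" if A: "mem x A" and B: "mem x B"
  proof -
    \<comment> \<open>On \<open>A\<close> the two indicators agree, hence so do the coordinates of
      any point containing \<open>A\<close>.\<close>
    have "continuous_map beta_omega euclidean (\<lambda>x. x (indicator (A \<inter> B)) - x (indicator B))"
      by (intro continuous_map_diff continuous_eval_indicator)
    then have "x (indicator (A \<inter> B)) - x (indicator B) \<in> {0}"
      by (rule mem_dense[rotated, where A = A]) (use A assms in \<open>auto simp: indicator_def\<close>)
    then show ?thesis using B by (simp add: mem_def)
  qed
  ultimately show ?thesis by blast
qed

text \<open>Provides functions \<open>ind A t\<close> whose extensions change the value at
  \<open>y\<close> and vanish on \<open>F\<close>.\<close>

lemma mem_separates_finite:
  assumes "finite F" "F \<subseteq> topspace beta_omega" "y \<in> topspace beta_omega" "y \<notin> F"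
  shows "\<exists>A. mem y A \<and> (\<forall>x\<in>F. \<not> mem x A)"
  using assms
proof (induction F)
  case empty
  then show ?case using mem_UNIV by auto
next
  case (insert x F)
  then obtain A where A: "mem y A" "\<forall>x\<in>F. \<not> mem x A" by auto
  obtain B where B: "mem y B" "\<not> mem x B"
    by (rule mem_separates[of y x]) (use insert in auto)
  have "mem y (A \<inter> B)" using A B insert.prems by (simp add: mem_Int)
  moreover have "\<forall>z\<in>insert x F. \<not> mem z (A \<inter> B)"
    using A B insert.prems by (auto simp: mem_Int)
  ultimately show ?case by blast
qed

text \<open>A point contains at most one of several disjoint sets, so choosing for each
  \<open>k\<close> a point of \<open>F\<close> that contains \<open>A k\<close> would inject the
  naturals into a finite set.\<close>

lemma finite_disjoint_not_mem:
  fixes A :: "nat \<Rightarrow> nat set"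
  assumes "finite F" "F \<subseteq> topspace beta_omega" "disjoint_family A"
  shows "\<exists>k. \<forall>x\<in>F. \<not> mem x (A k)"
proof (rule ccontr)
  assume "\<not> ?thesis"
  then obtain x where x: "\<And>k. x k \<in> F" "\<And>k. mem (x k) (A k)" by metis
  have "inj x"
  proof (rule injI, rule ccontr)
    fix k l assume "x k = x l" "k \<noteq> l"
    then have "A k \<inter> A l \<noteq> {}" using mem_disjoint[of "x k" "A k" "A l"] x assms(2)
      by (metis subsetD)
    then show False using assms(3) \<open>k \<noteq> l\<close> by (simp add: disjoint_family_on_def)
  qed
  moreover have "finite (range x)" using assms(1) x(1) by (meson finite_subset image_subsetI)
  ultimately show False using finite_imageD by blast
qed

text \<open>Representatives in \<open>[0, 1)\<close> turn a sequence in the circle into a coordinate of the cube.\<close>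

definition circle_rep :: "circle \<Rightarrow> real" where
  "circle_rep a = frac (rep_circle a)"

lemma circle_rep_bounds: "0 \<le> circle_rep a \<and> circle_rep a \<le> 1"
  by (simp add: circle_rep_def frac_ge_0 frac_lt_1 less_imp_le)

lemma to_circle_rep [simp]: "to_circle (circle_rep a) = a"
proof -
  have "to_circle (circle_rep a) = to_circle (rep_circle a)"
    by (simp add: circle_rep_def to_circle_eq_iff frac_def)
  then show ?thesis by (simp add: Quotient3_abs_rep[OF Quotient3_circle])
qed

text \<open>The jump of \<open>circle_rep\<close> does no harm: as omega is discrete, every sequence
  in [0, 1] is a coordinate of the cube.\<close>

definition beta_ext :: "(nat \<Rightarrow> circle) \<Rightarrow> ((nat \<Rightarrow> real) \<Rightarrow> real) \<Rightarrow> circle" where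
  "beta_ext f x = to_circle (x (\<lambda>i. circle_rep (f i)))"

lemma continuous_beta_ext: "continuous_map beta_omega euclidean (beta_ext f)"
proof -
  have "continuous_map euclidean euclidean to_circle" using continuous_to_circle by simp
  from continuous_map_compose[OF continuous_eval this] show ?thesis
    unfolding beta_ext_def by (simp add: o_def circle_rep_bounds)
qed

lemma beta_ext_pt [simp]: "beta_ext f (pt n) = f n"
  by (simp add: beta_ext_def pt_apply circle_rep_bounds)

text \<open>Representatives need not add, but their classes do on omega, and density carries the
  identity over.\<close>

lemma beta_ext_add:
  assumes "x \<in> topspace beta_omega" shows "beta_ext (\<lambda>i. f i + g i) x = beta_ext f x + beta_ext g x"
proof -
  have "continuous_map beta_omega euclidean (\<lambda>x. beta_ext (\<lambda>i. f i + g i) x + - beta_ext f x + - beta_ext g x)"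
    by (intro continuous_map_circle_add continuous_map_circle_minus continuous_beta_ext)
  then have "beta_ext (\<lambda>i. f i + g i) x + - beta_ext f x + - beta_ext g x \<in> {0}"
    by (rule mem_dense[rotated, where A = UNIV]) (use assms mem_UNIV in auto)
  then show ?thesis by (simp add: algebra_simps)
qed

lemma beta_ext_vanish:
  assumes "x \<in> topspace beta_omega" "\<not> mem x A" "\<And>i. i \<notin> A \<Longrightarrow> f i = 0"
  shows "beta_ext f x = 0"
proof -
  have "beta_ext f x \<in> {0}"
    by (rule mem_dense[OF _ continuous_beta_ext _ assms(1), where A = "- A"])
      (use assms in \<open>auto simp: mem_Compl\<close>)
  then show ?thesis by simp
qed

lemma beta_ext_ind:
  assumes "x \<in> topspace beta_omega" shows "beta_ext (ind A t) x = (if mem x A then t else 0)"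
proof (cases "mem x A")
  case True
  then have "beta_ext (ind A t) x \<in> {t}"
    by (intro mem_dense[OF _ continuous_beta_ext _ assms, where A = A]) (auto simp: ind_def)
  then show ?thesis using True by simp
qed (use beta_ext_vanish[OF assms] in \<open>auto simp: ind_def\<close>)

section \<open>Isolated points and the topology of \<open>omega_star\<close>\<close>

lemma beta_omega_isolated:
  assumes "x \<in> topspace beta_omega" "mem x {n}" shows "x = pt n"
proof (rule ccontr)
  assume "x \<noteq> pt n"
  then obtain A where "mem x A" "\<not> mem (pt n) A"
    by (rule mem_separates[OF assms(1) pt_in_beta_omega])
  then show False using mem_disjoint[OF assms(1) _ assms(2), of A] by auto
qed

lemma openin_mem: "openin beta_omega {x \<in> topspace beta_omega. mem x A}"
proof -
  have "openin beta_omega {x \<in> topspace beta_omega. x (indicator A) \<in> {0<..}}"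
    by (rule openin_continuous_map_preimage[OF continuous_eval_indicator]) auto
  moreover have "{x \<in> topspace beta_omega. x (indicator A) \<in> {0<..}} = {x \<in> topspace beta_omega. mem x A}"
    by (auto simp: eval_indicator split: if_splits)
  ultimately show ?thesis by simp
qed

lemma closedin_mem: "closedin beta_omega {x \<in> topspace beta_omega. mem x A}"
  using closedin_continuous_map_preimage[OF continuous_eval_indicator, of "{1}" A]
  by (simp add: mem_def)

lemma topspace_omega_star: "topspace omega_star = topspace beta_omega - range pt"
  by (auto simp: omega_star_def)

lemma omega_star_subset: "x \<in> topspace omega_star \<Longrightarrow> x \<in> topspace beta_omega"
  by (simp add: topspace_omega_star)

lemma compact_omega_star: "compact_space omega_star"
proof -
  have "range pt = (\<Union>n. {x \<in> topspace beta_omega. mem x {n}})"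
    using pt_in_beta_omega beta_omega_isolated by auto
  then have "openin beta_omega (range pt)" using openin_mem by auto
  then have "closedin beta_omega (topspace beta_omega - range pt)" by (rule closedin_diff[rotated]) simp
  then show ?thesis
    unfolding omega_star_def
    by (intro compact_space_subtopology closedin_compact_space compact_beta_omega)
qed

text \<open>Otherwise the clopen set of points containing \<open>A\<close> would consist of isolated
  points \<open>pt n\<close> only; being compact, it would be finite.\<close>

lemma omega_star_mem_infinite:
  assumes "infinite A"
  obtains x where "x \<in> topspace omega_star" "mem x A"
proof (rule ccontr)
  assume no: "\<not> thesis"
  define K where "K = {x \<in> topspace beta_omega. mem x A}"
  have K: "K \<subseteq> (\<Union>n\<in>A. {x \<in> topspace beta_omega. mem x {n}})"
  proof
    fix x assume x: "x \<in> K"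
    then have "x \<in> range pt" using no that by (auto simp: K_def topspace_omega_star)
    then show "x \<in> (\<Union>n\<in>A. {x \<in> topspace beta_omega. mem x {n}})"
      using x by (auto simp: K_def)
  qed
  have "compactin beta_omega K"
    unfolding K_def by (rule closedin_compact_space[OF compact_beta_omega closedin_mem])
  from this[unfolded compactin_def, THEN conjunct2, rule_format,
      of "(\<lambda>n. {x \<in> topspace beta_omega. mem x {n}}) ` A"]
  obtain \<F> where \<F>: "finite \<F>" "\<F> \<subseteq> (\<lambda>n. {x \<in> topspace beta_omega. mem x {n}}) ` A" "K \<subseteq> \<Union>\<F>"
    using K openin_mem by auto
  then obtain N where N: "N \<subseteq> A" "finite N" "\<F> = (\<lambda>n. {x \<in> topspace beta_omega. mem x {n}}) ` N"
    by (meson finite_subset_image)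
  have "A \<subseteq> N"
  proof
    fix n assume "n \<in> A"
    then have "pt n \<in> K" using pt_in_beta_omega by (simp add: K_def)
    then show "n \<in> N" using \<F>(3) N(3) by auto
  qed
  then show False using N(2) assms finite_subset by blast
qed

section \<open>Characters of groups of continuous functions\<close>

lemma carrier_Cp:
  "carrier (Cp X) = {f \<in> extensional (topspace X). continuous_map X euclidean f}"
  by (simp add: Cp_def pointwise_group_def)

lemma mult_Cp: "f \<otimes>\<^bsub>Cp X\<^esub> g = (\<lambda>x\<in>topspace X. f x + g x)"
  by (simp add: Cp_def pointwise_group_def)

lemma one_Cp: "\<one>\<^bsub>Cp X\<^esub> = (\<lambda>x\<in>topspace X. 0)"
  by (simp add: Cp_def pointwise_group_def)

lemma group_Cp: "group (Cp X)"
  using Cp_topgroup[of X] by (simp add: topological_ab_group_def comm_group_def)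

lemma gtop_Cp: "gtop (Cp X) = subtopology (product_topology (\<lambda>_. euclidean) (topspace X)) (carrier (Cp X))"
  by (simp add: Cp_def pointwise_group_def)

lemma topspace_gtop_Cp: "topspace (gtop (Cp X)) = carrier (Cp X)"
  using Cp_topgroup[of X] by (simp add: topological_ab_group_def)

text \<open>A basic neighbourhood constrains only finitely many coordinates, and each constraint
  admits the value 0.\<close>

lemma Cp_nhd_zero:
  assumes "openin (gtop (Cp X)) U" "\<one>\<^bsub>Cp X\<^esub> \<in> U"
  obtains F where "finite F" "F \<subseteq> topspace X"
    "\<And>f. f \<in> carrier (Cp X) \<Longrightarrow> (\<And>x. x \<in> F \<Longrightarrow> f x = 0) \<Longrightarrow> f \<in> U"
proof -
  obtain T where T: "openin (product_topology (\<lambda>_. euclidean) (topspace X)) T"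
    "U = T \<inter> carrier (Cp X)"
    using assms(1) by (auto simp: gtop_Cp openin_subtopology)
  then obtain W where W: "finite {x \<in> topspace X. W x \<noteq> UNIV}"
    "\<one>\<^bsub>Cp X\<^esub> \<in> PiE (topspace X) W" "PiE (topspace X) W \<subseteq> T"
    using assms(2) unfolding openin_product_topology_alt by fastforce
  show thesis
  proof (rule that[OF W(1)])
    fix f assume f: "f \<in> carrier (Cp X)" "\<And>x. x \<in> {x \<in> topspace X. W x \<noteq> UNIV} \<Longrightarrow> f x = 0"
    have "f x \<in> W x" if "x \<in> topspace X" for x
      using W(2) f(2)[of x] that by (cases "W x = UNIV") (auto simp: one_Cp PiE_iff)
    then have "f \<in> PiE (topspace X) W" using f(1) by (simp add: carrier_Cp PiE_iff)
    then show "f \<in> U" using W(3) T(2) f(1) by blast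
  qed auto
qed

lemma character_mult:
  assumes "h \<in> characters G" "x \<in> carrier G" "y \<in> carrier G"
  shows "h (x \<otimes>\<^bsub>G\<^esub> y) = h x + h y"
  using assms by (simp add: characters_def hom_def circle_group_def)

lemma character_one:
  assumes "group G" "h \<in> characters G" shows "h \<one>\<^bsub>G\<^esub> = 0"
proof -
  interpret group G by fact
  show ?thesis using character_mult[OF assms(2), of "\<one>\<^bsub>G\<^esub>" "\<one>\<^bsub>G\<^esub>"] by simp
qed

lemma continuous_character: "h \<in> characters G \<Longrightarrow> continuous_map (gtop G) euclidean h"
  by (simp add: characters_def)

text \<open>Let \<open>F\<close> determine a neighbourhood of zero with values in a small arc. The
  functions vanishing on \<open>F\<close> are closed under doubling, so their image in that arc is
  trivial.\<close>

lemma character_finite_support: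
  assumes \<phi>: "\<phi> \<in> characters (Cp X)"
  obtains F where "finite F" "F \<subseteq> topspace X"
    "\<And>f. f \<in> carrier (Cp X) \<Longrightarrow> (\<And>x. x \<in> F \<Longrightarrow> f x = 0) \<Longrightarrow> \<phi> f = 0"
proof -
  interpret group "Cp X" by (rule group_Cp)
  define U where "U = {f \<in> topspace (gtop (Cp X)). \<phi> f \<in> circle_arc (1/4)}"
  have "openin (gtop (Cp X)) U"
    unfolding U_def by (rule openin_continuous_map_preimage[OF continuous_character[OF \<phi>]])
      (simp add: open_circle_arc)
  moreover have "\<one>\<^bsub>Cp X\<^esub> \<in> U"
    by (simp add: U_def topspace_gtop_Cp character_one[OF group_Cp \<phi>] zero_in_circle_arc)
  ultimately obtain F where F: "finite F" "F \<subseteq> topspace X"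
    "\<And>f. f \<in> carrier (Cp X) \<Longrightarrow> (\<And>x. x \<in> F \<Longrightarrow> f x = 0) \<Longrightarrow> f \<in> U"
    using Cp_nhd_zero by blast
  define Z where "Z = {f \<in> carrier (Cp X). \<forall>x\<in>F. f x = 0}"
  have Z2: "f \<otimes>\<^bsub>Cp X\<^esub> f \<in> Z" if "f \<in> Z" for f
    using that m_closed[of f f] F(2) by (auto simp: Z_def mult_Cp)
  show thesis
  proof (rule that[OF F(1,2)])
    fix f assume f: "f \<in> carrier (Cp X)" "\<And>x. x \<in> F \<Longrightarrow> f x = 0"
    show "\<phi> f = 0"
    proof (rule circle_arc_no_small_subgroups[of "\<phi> ` Z"])
      fix a assume "a \<in> \<phi> ` Z"
      then obtain g where "g \<in> Z" "a = \<phi> g" by auto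
      then have "a + a = \<phi> (g \<otimes>\<^bsub>Cp X\<^esub> g)" by (simp add: character_mult[OF \<phi>] Z_def)
      then show "a + a \<in> \<phi> ` Z" using Z2[OF \<open>g \<in> Z\<close>] by blast
    next
      show "\<phi> ` Z \<subseteq> circle_arc (1/4)" using F(3) by (auto simp: Z_def U_def)
    qed (use f in \<open>simp add: Z_def\<close>)
  qed
qed

section \<open>Extended sequences as elements of the function group\<close>

definition star_ext :: "(nat \<Rightarrow> circle) \<Rightarrow> ((nat \<Rightarrow> real) \<Rightarrow> real) \<Rightarrow> circle" where
  "star_ext f = restrict (beta_ext f) (topspace omega_star)"

lemma star_ext_carrier: "star_ext f \<in> carrier (Cp omega_star)"
proof -
  have "continuous_map omega_star euclidean (beta_ext f)"
    unfolding omega_star_def by (intro continuous_map_from_subtopology continuous_beta_ext)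
  then have "continuous_map omega_star euclidean (star_ext f)"
    by (rule continuous_map_eq) (simp add: star_ext_def)
  then show ?thesis by (simp add: carrier_Cp star_ext_def)
qed

lemma star_ext_add: "star_ext (\<lambda>i. f i + g i) = star_ext f \<otimes>\<^bsub>Cp omega_star\<^esub> star_ext g"
  by (auto simp: star_ext_def mult_Cp beta_ext_add omega_star_subset)

lemma star_ext_ind:
  "x \<in> topspace omega_star \<Longrightarrow> star_ext (ind A t) x = (if mem x A then t else 0)"
  by (simp add: star_ext_def beta_ext_ind omega_star_subset)

text \<open>Each coordinate is the identity or zero as a function of \<open>t\<close>; this supplies
  \<open>cont\<close> of the gliding hump.\<close>

lemma continuous_star_ext_ind: "continuous_map euclidean (gtop (Cp omega_star)) (\<lambda>t. star_ext (ind A t))"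
  unfolding gtop_Cp continuous_map_in_subtopology continuous_map_componentwise
proof (intro conjI ballI)
  fix x assume x: "x \<in> topspace omega_star"
  show "continuous_map euclidean euclidean (\<lambda>t. star_ext (ind A t) x)"
    by (cases "mem x A") (simp_all add: star_ext_ind[OF x])
qed (use star_ext_carrier in \<open>auto simp: star_ext_def\<close>)

text \<open>On the finite support of a character, a continuous function agrees with a finite sum of
  functions \<open>star_ext (ind A t)\<close>.\<close>

lemma character_zero_on_ind:
  assumes \<phi>: "\<phi> \<in> characters (Cp omega_star)" and zero: "\<And>A t. \<phi> (star_ext (ind A t)) = 0"
    and f: "f \<in> carrier (Cp omega_star)"
  shows "\<phi> f = 0"
proof -
  interpret group "Cp omega_star" by (rule group_Cp)
  obtain F where F: "finite F" "F \<subseteq> topspace omega_star"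
    "\<And>f. f \<in> carrier (Cp omega_star) \<Longrightarrow> (\<And>x. x \<in> F \<Longrightarrow> f x = 0) \<Longrightarrow> \<phi> f = 0"
    by (rule character_finite_support[OF \<phi>]) blast
  \<comment> \<open>The sign makes \<open>f\<close> plus the extension of \<open>g\<close> vanish on
    \<open>F\<close>, so the character kills the sum, and with it \<open>f\<close>.\<close>
  have "\<exists>g. \<phi> (star_ext g) = 0 \<and> (\<forall>x\<in>F. star_ext g x = - f x)"
    using F(1,2)
  proof (induction F)
    case empty
    then show ?case using zero by auto
  next
    case (insert y F)
    then obtain g where g: "\<phi> (star_ext g) = 0" "\<forall>x\<in>F. star_ext g x = - f x" by auto
    have sub: "F \<subseteq> topspace beta_omega" "y \<in> topspace beta_omega"
      using insert.prems omega_star_subset by auto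
    then obtain A where A: "mem y A" "\<forall>x\<in>F. \<not> mem x A"
      using mem_separates_finite[OF insert.hyps(1)] insert.hyps(2) by blast
    \<comment> \<open>\<open>A\<close> separates \<open>y\<close> from \<open>F\<close>, so this
      correction at \<open>y\<close> leaves the values on \<open>F\<close> unchanged.\<close>
    define h where "h = ind A (- f y - star_ext g y)"
    have "\<phi> (star_ext (\<lambda>i. g i + h i)) = 0"
      using g zero by (simp add: star_ext_add character_mult[OF \<phi>] star_ext_carrier h_def)
    moreover have "star_ext (\<lambda>i. g i + h i) x = - f x" if "x \<in> insert y F" for x
    proof -
      have x: "x \<in> topspace omega_star" using insert.prems that by auto
      have "star_ext (\<lambda>i. g i + h i) x = star_ext g x + (if mem x A then - f y - star_ext g y else 0)"
        using star_ext_ind[OF x] x by (simp add: star_ext_add mult_Cp h_def)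
      then show ?thesis using A g that by auto
    qed
    ultimately show ?case by blast
  qed
  then obtain g where g: "\<phi> (star_ext g) = 0" "\<forall>x\<in>F. star_ext g x = - f x" by blast
  have "\<phi> (f \<otimes>\<^bsub>Cp omega_star\<^esub> star_ext g) = 0"
    using F(2) g(2) by (intro F(3) m_closed f star_ext_carrier) (auto simp: mult_Cp)
  then show ?thesis using g(1) by (simp add: character_mult[OF \<phi> f star_ext_carrier])
qed

section \<open>Pointwise null sequences of characters and g-density\<close>

theorem characters_eventually_zero:
  assumes \<phi>: "\<And>n. \<phi> n \<in> characters (Cp omega_star)"
    and lim: "\<And>f. f \<in> carrier (Cp omega_star) \<Longrightarrow> (\<lambda>n. \<phi> n f) \<longlonglongrightarrow> 0"
  shows "\<forall>\<^sub>F n in sequentially. \<forall>f\<in>carrier (Cp omega_star). \<phi> n f = 0"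
proof -
  interpret gliding_hump "\<lambda>n f. \<phi> n (star_ext f)"
  proof
    fix n and f g :: "nat \<Rightarrow> circle"
    show "\<phi> n (star_ext (\<lambda>i. f i + g i)) = \<phi> n (star_ext f) + \<phi> n (star_ext g)"
      by (simp add: star_ext_add character_mult[OF \<phi>] star_ext_carrier)
  next
    fix n and B :: "nat set"
    show "continuous_on UNIV (\<lambda>t. \<phi> n (star_ext (ind B t)))"
      using continuous_map_compose[OF continuous_star_ext_ind continuous_character[OF \<phi>]]
      by (simp add: o_def)
  next
    fix n and A :: "nat \<Rightarrow> nat set" assume A: "disjoint_family A"
    obtain F where F: "finite F" "F \<subseteq> topspace omega_star"
      "\<And>f. f \<in> carrier (Cp omega_star) \<Longrightarrow> (\<And>x. x \<in> F \<Longrightarrow> f x = 0) \<Longrightarrow> \<phi> n f = 0"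
      by (rule character_finite_support[OF \<phi>]) blast
    then have "F \<subseteq> topspace beta_omega" using omega_star_subset by auto
    then obtain k where k: "\<forall>x\<in>F. \<not> mem x (A k)"
      using finite_disjoint_not_mem[OF F(1) _ A] by blast
    \<comment> \<open>As no point of \<open>F\<close> contains \<open>A k\<close>, a sequence
      supported in \<open>A k\<close> extends to a function vanishing on \<open>F\<close>.\<close>
    have "\<phi> n (star_ext f) = 0" if "\<forall>i. i \<notin> A k \<longrightarrow> f i = 0" for f
    proof (rule F(3)[OF star_ext_carrier])
      fix x assume "x \<in> F"
      then show "star_ext f x = 0"
        using F(2) k that beta_ext_vanish[of x "A k" f] omega_star_subset by (auto simp: star_ext_def)
    qed
    then show "\<exists>k. \<forall>f. (\<forall>i. i \<notin> A k \<longrightarrow> f i = 0) \<longrightarrow> \<phi> n (star_ext f) = 0" by blast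
  next
    fix f show "(\<lambda>n. \<phi> n (star_ext f)) \<longlonglongrightarrow> 0" by (rule lim[OF star_ext_carrier])
  qed
  show ?thesis
    using eventually_zero_on_indicators
    by eventually_elim (use character_zero_on_ind[OF \<phi>] in blast)
qed

text \<open>Characters of \<open>K\<close> pull back along \<open>e\<close> to characters that are
  eventually identically zero. By density and continuity they are eventually zero on
  \<open>K\<close> itself, so convergence there is immediate.\<close>

lemma g_dense_completion:
  assumes K: "is_completion (Cp omega_star) K e"
  shows "g_dense (e ` carrier (Cp omega_star)) K"
proof -
  let ?G = "Cp omega_star"
  have e: "e \<in> hom ?G K" and emb: "embedding_map (gtop ?G) (gtop K) e"
    and dense: "gtop K closure_of (e ` carrier ?G) = carrier K"
    and K': "topological_ab_group K"
    using K by (auto simp: is_completion_def)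
  have gK: "group K" using K' by (simp add: topological_ab_group_def comm_group_def)
  have contE: "continuous_map (gtop ?G) (gtop K) e"
    using emb unfolding embedding_map_def
    by (intro continuous_map_into_fulltopology[OF homeomorphic_imp_continuous_map])
  have eK: "e f \<in> carrier K" if "f \<in> carrier ?G" for f using e that by (auto simp: hom_def)
  interpret group_hom ?G K e
    by (intro group_hom.intro group_hom_axioms.intro group_Cp gK e)
  have "s_set K u = carrier K"
    if u: "\<And>n. u n \<in> characters K" and sub: "e ` carrier ?G \<subseteq> s_set K u" for u
  proof -
    define \<phi> where "\<phi> n = restrict (u n \<circ> e) (carrier ?G)" for n
    have "\<phi> n \<in> characters ?G" for n
    proof -
      have "continuous_map (gtop ?G) euclidean (u n \<circ> e)"
        by (rule continuous_map_compose[OF contE continuous_character[OF u]])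
      then have "continuous_map (gtop ?G) euclidean (\<phi> n)"
        by (rule continuous_map_eq) (simp add: \<phi>_def topspace_gtop_Cp)
      moreover have "\<phi> n \<in> hom ?G circle_group"
        by (auto simp: hom_def circle_group_def \<phi>_def eK character_mult[OF u])
      ultimately show ?thesis by (simp add: characters_def \<phi>_def)
    qed
    moreover have "(\<lambda>n. \<phi> n f) \<longlonglongrightarrow> 0" if "f \<in> carrier ?G" for f
      using sub that by (auto simp: \<phi>_def s_set_def)
    ultimately have "\<forall>\<^sub>F n in sequentially. \<forall>f\<in>carrier ?G. \<phi> n f = 0"
      by (rule characters_eventually_zero)
    then have ev: "\<forall>\<^sub>F n in sequentially. \<forall>x\<in>carrier K. u n x = 0"
    proof eventually_elim
      fix n assume n: "\<forall>f\<in>carrier ?G. \<phi> n f = 0"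
      show "\<forall>x\<in>carrier K. u n x = 0"
      proof
        fix x assume "x \<in> carrier K"
        then have "x \<in> gtop K closure_of (e ` carrier ?G)" using dense by simp
        then show "u n x = 0"
          by (rule forall_in_closure_of_eq[OF _ Hausdorff_circle continuous_character[OF u]])
            (use n in \<open>auto simp: \<phi>_def\<close>)
      qed
    qed
    have "(\<lambda>n. u n x) \<longlonglongrightarrow> 0" if "x \<in> carrier K" for x
      by (rule tendsto_eventually, rule eventually_mono[OF ev]) (use that in blast)
    then show ?thesis by (auto simp: s_set_def)
  qed
  then show ?thesis using img_is_subgroup by (simp add: g_dense_def)
qed

text \<open>The evaluations at the points of \<open>omega_star\<close> form a compact set, and no neighbourhood of
  zero, being determined by finitely many points, controls all of them.\<close>

lemma not_g_barrelled: "\<not> g_barrelled (Cp omega_star)"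
proof
  assume barrelled: "g_barrelled (Cp omega_star)"
  let ?G = "Cp omega_star"
  interpret group ?G by (rule group_Cp)
  define \<delta> where "\<delta> x = (\<lambda>f\<in>carrier ?G. f x :: circle)" for x
  have \<delta>: "\<delta> x \<in> characters ?G" if x: "x \<in> topspace omega_star" for x
  proof -
    have "continuous_map (gtop ?G) euclidean (\<lambda>f. f x)"
      unfolding gtop_Cp
      by (intro continuous_map_from_subtopology continuous_map_product_projection x)
    then have "continuous_map (gtop ?G) euclidean (\<delta> x)"
      by (rule continuous_map_eq) (simp add: \<delta>_def topspace_gtop_Cp)
    moreover have "\<delta> x \<in> hom ?G circle_group"
    proof -
      have "\<delta> x (f \<otimes>\<^bsub>?G\<^esub> g) = \<delta> x f + \<delta> x g" if "f \<in> carrier ?G" "g \<in> carrier ?G" for f g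
        using m_closed[OF that] that x by (simp add: \<delta>_def mult_Cp)
      then show ?thesis by (simp add: hom_def circle_group_def)
    qed
    ultimately show ?thesis by (simp add: characters_def \<delta>_def)
  qed
  have "continuous_map omega_star (gtop (dual_p ?G)) \<delta>"
  proof -
    \<comment> \<open>The coordinate of \<open>\<delta>\<close> at \<open>f\<close> is
      \<open>f\<close> itself, which is continuous.\<close>
    have "continuous_map omega_star (product_topology (\<lambda>_. euclidean) (carrier ?G)) \<delta>"
      unfolding continuous_map_componentwise by (auto simp: \<delta>_def carrier_Cp)
    then show ?thesis
      using \<delta> by (auto simp: dual_p_def pointwise_group_def continuous_map_in_subtopology)
  qed
  then have "compactin (gtop (dual_p ?G)) (\<delta> ` topspace omega_star)"
    using image_compactin compact_omega_star unfolding compact_space_def by blast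
  then have "equicontinuous_in ?G (\<delta> ` topspace omega_star)"
    using barrelled by (simp add: g_barrelled_def)
  \<comment> \<open>Equicontinuity at the identity, tested with an arc that misses the element of
    order two.\<close>
  then obtain U where U: "openin (gtop ?G) U" "\<one>\<^bsub>?G\<^esub> \<in> U"
    "\<forall>h\<in>\<delta> ` topspace omega_star. \<forall>f\<in>U. h f - h \<one>\<^bsub>?G\<^esub> \<in> circle_arc (1/4)"
    unfolding equicontinuous_in_def using open_circle_arc[of "1/4"] zero_in_circle_arc[of "1/4"]
    by (metis one_closed zero_less_divide_1_iff zero_less_numeral)
  obtain F where F: "finite F" "F \<subseteq> topspace omega_star"
    "\<And>f. f \<in> carrier ?G \<Longrightarrow> (\<And>x. x \<in> F \<Longrightarrow> f x = 0) \<Longrightarrow> f \<in> U"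
    by (rule Cp_nhd_zero[OF U(1,2)]) blast
  \<comment> \<open>Disjoint infinite sets: some \<open>A k\<close> belongs to no point of
    \<open>F\<close>, yet it belongs to some \<open>y\<close> in \<open>omega_star\<close>.\<close>
  define A where "A k = range (\<lambda>j. prod_encode (k, j))" for k
  have "disjoint_family A" by (auto simp: disjoint_family_on_def A_def)
  moreover have "F \<subseteq> topspace beta_omega" using F(2) omega_star_subset by auto
  ultimately obtain k where k: "\<forall>x\<in>F. \<not> mem x (A k)"
    using finite_disjoint_not_mem[OF F(1)] by blast
  have "infinite (A k)"
    unfolding A_def by (intro range_inj_infinite injI) simp
  then obtain y where y: "y \<in> topspace omega_star" "mem y (A k)"
    by (rule omega_star_mem_infinite)
  \<comment> \<open>Vanishing on \<open>F\<close> puts \<open>f\<close> into \<open>U\<close>, while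
    its value at \<open>y\<close> is the class of 1/2.\<close>
  define f where "f = star_ext (ind (A k) (to_circle (1/2)))"
  have "f \<in> U"
    unfolding f_def using F(2) k by (intro F(3) star_ext_carrier) (auto simp: star_ext_ind)
  then have "\<delta> y f - \<delta> y \<one>\<^bsub>?G\<^esub> \<in> circle_arc (1/4)" using U(3) y(1) by blast
  then have "f y \<in> circle_arc (1/4)"
    using y(1) one_closed by (simp add: \<delta>_def f_def star_ext_carrier) (simp add: one_Cp)
  then have "to_circle (1/2) \<in> circle_arc (1/4)" using y by (simp add: f_def star_ext_ind)
  then obtain z :: real where z: "\<bar>z\<bar> < 1/4" "1/2 - z \<in> \<int>" by (auto simp: circle_arc_def to_circle_eq_iff)
  then have "1/2 - z = 0" by (intro Ints_nonzero_abs_less1) auto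
  then show False using z by simp
qed

theorem corollary3p14:
  "(\<forall>(K :: 'k top_group) e. is_completion (Cp omega_star) K e \<longrightarrow>
      g_dense (e ` carrier (Cp omega_star)) K) \<and>
   \<not> g_barrelled (Cp omega_star)"
  using g_dense_completion not_g_barrelled by blast

end
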